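(* Let $\lambda>0$ and consider, in dimension $d=1$, the Kinetic Isothermal Euler system $$\partial_tf+\xi\,\partial_xf-\lambda\,\partial_x(\ln\rho)\,\partial_\xi f=0,\qquad\rho(t,x)=\int_{\mathbb R}f(t,x,\xi)\,d\xi.\tag{KIE}$$ 1. Let $c_{1,0}>0$, $c_{2,0}>0$ and $c_{1,1},B_0,B_1\in\mathbb R$. Let $c_1\in\mathcal C^\infty(\mathbb R^+)$ be the solution of $$\ddot c_1=\frac{2\lambda}{c_1}+\frac{\tilde C^2}{c_1^3},\qquad\tilde C:=c_{1,0}\,c_{2,0},\qquad c_1(0)=c_{1,0},\quad\dot c_1(0)=c_{1,1},\tag{a}$$ and set $$c_2(t):=\frac{\tilde C}{c_1(t)},\qquad b_1(t):=B_1t+B_0,\qquad b_2(t,x):=\frac{\dot c_1(t)}{c_1(t)}(x-B_1t-B_0)+B_1.\tag{b}$$ Then $$f(t,x,\xi)=\frac1{\pi\,c_1(t)\,c_2(t)}\exp\left[-\frac{|x-b_1(t)|^2}{c_1(t)^2}-\frac{|\xi-b_2(t,x)|^2}{c_2(t)^2}\right]$$ is a solution to (KIE). Moreover, if $\tilde f=\tilde f(t,y,\eta)$ is defined by $$f(t,x,\xi)=\frac1{\|\gamma^2\|_{L^1}}\tilde f\Big(t,\frac x{\tau(t)},\tau(t)\xi-\dot\tau(t)x\Big)$$ and $\tilde\rho(t,y):=\int_{\mathbb R}\tilde f(t,y,\eta)\,d\eta$, then $$\|\tilde\rho(t,\cdot)-\gamma^2\|_{L^1}=O\left(\sqrt{\frac{\ln\ln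 t}{\ln t}}\right)\qquad(t\to\infty).$$ 2. Let $T\in(0,+\infty]$, $b_1\in\mathcal C^1([0,T),\mathbb R)$, $c_1\in\mathcal C^1([0,T),(0,\infty))$, $b_2=b_2(t,x)\in\mathcal C^1([0,T)\times\mathbb R,\mathbb R)$ and $c_2=c_2(t,x)\in\mathcal C^1([0,T)\times\mathbb R,(0,\infty))$ be such that $$f(t,x,\xi)=\frac1{\pi\,c_1(t)\,c_2(t,x)}\exp\left[-\frac{|x-b_1(t)|^2}{c_1(t)^2}-\frac{|\xi-b_2(t,x)|^2}{c_2(t,x)^2}\right],\qquad t\in[0,T),\ x,\xi\in\mathbb R,$$ is a solution to (KIE). Then $c_2$ does not depend on $x$, all the functions $b_1,c_1,b_2,c_2$ are $\mathcal C^\infty$, and the relations (a) and (b) hold on $[0,T)$ (with $c_{1,0}=c_1(0)$, $c_{1,1}=\dot c_1(0)$, $c_{2,0}=c_2(0)$ and some $B_0,B_1\in\mathbb R$).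
   Context: $\gamma(x)=e^{-x^2/2}$ on $\mathbb R$, so $\|\gamma^2\|_{L^1}=\sqrt\pi$. $\tau\in\mathcal C^\infty(\mathbb R)$ is the solution of $\ddot\tau=2\lambda/\tau$, $\tau(0)=1$, $\dot\tau(0)=0$. $\mathbb R^+=[0,\infty)$. Solutions of (KIE) here are classical (pointwise) solutions. *)

theory Defs
  imports "HOL-Analysis.Analysis" "HOL-Library.Landau_Symbols"
begin

text \<open>
  \<open>C\<^sup>k\<close> regularity on a set that need not be open. It is only used for sets on which derivatives
  within the set are unique (intervals \<open>[0,T)\<close>, strips \<open>[0,T) \<times> \<real>\<close>, the line); at \<open>t = 0\<close> the
  derivatives are one-sided.
\<close>

primrec Ck_on :: "nat \<Rightarrow> 'a::real_normed_vector set \<Rightarrow> ('a \<Rightarrow> 'b::real_normed_vector) \<Rightarrow> bool" where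
  "Ck_on 0 S f \<longleftrightarrow> continuous_on S f"
| "Ck_on (Suc k) S f \<longleftrightarrow>
     (\<exists>f'. (\<forall>x\<in>S. (f has_derivative f' x) (at x within S)) \<and> (\<forall>v. Ck_on k S (\<lambda>x. f' x v)))"

definition Cinf_on :: "'a::real_normed_vector set \<Rightarrow> ('a \<Rightarrow> 'b::real_normed_vector) \<Rightarrow> bool" where
  "Cinf_on S f \<longleftrightarrow> (\<forall>k. Ck_on k S f)"

definition Dt :: "real set \<Rightarrow> (real \<Rightarrow> real) \<Rightarrow> real \<Rightarrow> real" where
  "Dt I c t = vector_derivative c (at t within I)"

definition time_interval :: "ereal \<Rightarrow> real set" where
  "time_interval T = {t. 0 \<le> t \<and> ereal t < T}"

definition L1_norm :: "(real \<Rightarrow> real) \<Rightarrow> real" where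
  "L1_norm g = (\<integral>x. \<bar>g x\<bar> \<partial>lborel)"

definition gauss :: "real \<Rightarrow> real" where
  "gauss x = exp (- x\<^sup>2 / 2)"

definition spatial_density :: "(real \<Rightarrow> real \<Rightarrow> real \<Rightarrow> real) \<Rightarrow> real \<Rightarrow> real \<Rightarrow> real" where
  "spatial_density f t x = (\<integral>\<xi>. f t x \<xi> \<partial>lborel)"

text \<open>
  Classical solutions on a time interval \<open>I\<close>. Integrability and positivity of the density are
  required because Bochner integrals and \<open>ln\<close> are total functions in HOL.
\<close>

definition KIE_solution :: "real \<Rightarrow> real set \<Rightarrow> (real \<Rightarrow> real \<Rightarrow> real \<Rightarrow> real) \<Rightarrow> bool" where
  "KIE_solution lam I f \<longleftrightarrow>
     (\<forall>t\<in>I. \<forall>x. integrable lborel (f t x) \<and> spatial_density f t x > 0) \<and>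
     (\<forall>t\<in>I. \<forall>x \<xi>. \<exists>ft fx f\<xi> r.
        ((\<lambda>s. f s x \<xi>) has_real_derivative ft) (at t within I) \<and>
        ((\<lambda>y. f t y \<xi>) has_real_derivative fx) (at x) \<and>
        ((\<lambda>\<eta>. f t x \<eta>) has_real_derivative f\<xi>) (at \<xi>) \<and>
        ((\<lambda>y. ln (spatial_density f t y)) has_real_derivative r) (at x) \<and>
        ft + \<xi> * fx - lam * r * f\<xi> = 0)"

definition gaussian_ansatz ::
  "(real \<Rightarrow> real) \<Rightarrow> (real \<Rightarrow> real) \<Rightarrow> (real \<Rightarrow> real \<Rightarrow> real) \<Rightarrow> (real \<Rightarrow> real \<Rightarrow> real)
    \<Rightarrow> real \<Rightarrow> real \<Rightarrow> real \<Rightarrow> real" where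
  "gaussian_ansatz b1 c1 b2 c2 t x \<xi> =
     1 / (pi * c1 t * c2 t x) *
       exp (- (\<bar>x - b1 t\<bar>\<^sup>2 / (c1 t)\<^sup>2) - \<bar>\<xi> - b2 t x\<bar>\<^sup>2 / (c2 t x)\<^sup>2)"

text \<open>
  In the two differential equations below, nonvanishing of the unknown only expresses that the
  right-hand side is meaningful (division by \<open>0\<close> yields \<open>0\<close> in HOL).
\<close>

definition is_tau :: "real \<Rightarrow> (real \<Rightarrow> real) \<Rightarrow> bool" where
  "is_tau lam \<tau> \<longleftrightarrow>
     Cinf_on UNIV \<tau> \<and> \<tau> 0 = 1 \<and> Dt UNIV \<tau> 0 = 0 \<and>
     (\<forall>t. \<tau> t \<noteq> 0 \<and> Dt UNIV (Dt UNIV \<tau>) t = 2 * lam / \<tau> t)"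

definition relation_a :: "real \<Rightarrow> real set \<Rightarrow> real \<Rightarrow> real \<Rightarrow> real \<Rightarrow> (real \<Rightarrow> real) \<Rightarrow> bool" where
  "relation_a lam I c10 c11 c20 c1 \<longleftrightarrow>
     c1 0 = c10 \<and> Dt I c1 0 = c11 \<and>
     (\<forall>t\<in>I. c1 t \<noteq> 0 \<and>
        Dt I (Dt I c1) t = 2 * lam / c1 t + (c10 * c20)\<^sup>2 / (c1 t) ^ 3)"

definition relation_b ::
  "real set \<Rightarrow> real \<Rightarrow> real \<Rightarrow> real \<Rightarrow> real
    \<Rightarrow> (real \<Rightarrow> real) \<Rightarrow> (real \<Rightarrow> real) \<Rightarrow> (real \<Rightarrow> real \<Rightarrow> real) \<Rightarrow> (real \<Rightarrow> real) \<Rightarrow> bool" where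
  "relation_b I c10 c20 B0 B1 b1 c1 b2 c2 \<longleftrightarrow>
     (\<forall>t\<in>I. c2 t = c10 * c20 / c1 t \<and> b1 t = B1 * t + B0 \<and>
        (\<forall>x. b2 t x = Dt I c1 t / c1 t * (x - B1 * t - B0) + B1))"

end

theory Submission
  imports Defs "HOL-Probability.Distributions" "HOL-Real_Asymp.Real_Asymp"
begin

text \<open>
  Divided by \<open>f\<close>, the kinetic equation for a Gaussian ansatz is a cubic polynomial in \<open>\<xi> - b2\<close> that
  has to vanish identically. Its leading coefficient kills the \<open>x\<close>-dependence of \<open>c2\<close>; the other
  coefficients give \<open>c1 c2 = const\<close>, the affine form of \<open>b2\<close>, and the ordinary differential equations
  for \<open>b1\<close> and \<open>c1\<close>. Smoothness follows by bootstrapping the equation for \<open>c1\<close>.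

  The rescaled density is a Gaussian of width \<open>c1 / \<tau>\<close> and centre \<open>b1 / \<tau>\<close>, so its distance to
  \<open>\<gamma>\<^sup>2\<close> is at most a constant times \<open>\<bar>c1 / \<tau> - 1\<bar> + \<bar>b1\<bar> / \<tau>\<close>. Both \<open>c1\<close> and \<open>\<tau>\<close> solve
  \<open>u'' = 2 lam / u + C\<^sup>2 / u\<^sup>3\<close>. Conservation of energy shows that \<open>u / (2 \<surd>(lam ln u))\<close> equals
  \<open>t (1 + O(1 / ln t))\<close> for every such solution, hence \<open>c1 / \<tau> - 1 = O(1 / ln t)\<close>, while
  \<open>b1 / \<tau> = O(1 / \<surd>(ln t))\<close>.
\<close>

section \<open>Gaussian integrals\<close>

text \<open>The scale equation is compared only through quotients. The constants \<open>C\<close>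
  and \<open>K\<close> (the energy level, set by the initial data) enter \<open>u'\<close> at
  relative order 1 / ln u. Dividing \<open>u\<close> by the slowly varying
  \<open>2 * sqrt (lam * ln u)\<close> gives a function of slope almost 1, and since the integral of
  1 / ln t is O(t / ln t), the relative error survives integration. Logarithms then turn the
  quotient of two solutions into a difference. The stated rate leaves room: the width contributes 1
  / ln t and the centre 1 / sqrt (ln t), which dominates but stays below the bound by the factor
  sqrt (ln ln t). One pointwise equivalence, \<open>ansatz_kinetic_iff\<close>, serves both halves:
  vanishing coefficients verify the explicit solution, and an equation valid for all \<xi> forces
  them to vanish. As \<open>f\<close> is prescribed only for times in \<open>I\<close>, time
  derivatives are taken within \<open>I\<close>, and their uniqueness rests on
  \<open>at t within I\<close> being nontrivial.\<close>

lemma has_bochner_integral_exp_square: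
  fixes m s :: real
  assumes "s > 0"
  shows "has_bochner_integral lborel (\<lambda>y. exp (- ((y - m)\<^sup>2 / s\<^sup>2))) (sqrt pi * s)"
proof -
  \<comment> \<open>The exponent lacks the usual factor 1/2, so width \<open>s\<close> means
    standard deviation \<open>s / sqrt 2\<close>.\<close>
  have "exp (- ((y - m)\<^sup>2 / s\<^sup>2)) = (sqrt pi * s) * normal_density m (s / sqrt 2) y" for y
    using assms by (simp add: normal_density_def power_divide real_sqrt_mult)
  moreover have "has_bochner_integral lborel (normal_density m (s / sqrt 2)) 1"
    using assms by (simp add: has_bochner_integral_iff)
  ultimately show ?thesis
    using has_bochner_integral_mult_right[of "sqrt pi * s" lborel "normal_density m (s / sqrt 2)" 1]
    by simp
qed

lemma gauss_square: "(gauss y)\<^sup>2 = exp (- y\<^sup>2)"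
  by (simp add: gauss_def power2_eq_square flip: exp_add)

lemma has_bochner_integral_gauss_square:
  "has_bochner_integral lborel (\<lambda>y. (gauss y)\<^sup>2) (sqrt pi)"
  using has_bochner_integral_exp_square[of 1 0] by (simp add: gauss_square)

lemma L1_norm_gauss_square: "L1_norm (\<lambda>y. (gauss y)\<^sup>2) = sqrt pi"
  using has_bochner_integral_gauss_square
  by (simp add: L1_norm_def has_bochner_integral_integral_eq)

section \<open>Lipschitz dependence of a Gaussian on its width and centre\<close>

lemma exp_diff_le_max:
  fixes a b c :: real
  assumes "a \<le> c" "b \<le> c"
  shows "\<bar>exp a - exp b\<bar> \<le> \<bar>a - b\<bar> * exp c"
proof -
  have *: "exp y - exp x \<le> (y - x) * exp c" if "x \<le> y" "y \<le> c" for x y :: real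
  proof -
    have "exp y - exp x = (1 - exp (x - y)) * exp y"
      by (simp add: algebra_simps flip: exp_add)
    also have "\<dots> \<le> (y - x) * exp c"
    proof (intro mult_mono)
      show "1 - exp (x - y) \<le> y - x" using exp_ge_add_one_self[of "x - y"] by linarith
    qed (use that in auto)
    finally show ?thesis .
  qed
  show ?thesis
    using *[of a b] *[of b a] assms by (cases "a \<le> b") auto
qed

text \<open>The closeness assumptions only keep the width away from \<open>0\<close> and \<open>\<infinity>\<close>, so that one Gaussian
  dominates all the densities.\<close>

lemma gaussian_pointwise_diff:
  fixes s m y :: real
  assumes "\<bar>s - 1\<bar> \<le> 1/2" "\<bar>m\<bar> \<le> 1"
  shows "\<bar>1 / s * exp (- ((y - m)\<^sup>2 / s\<^sup>2)) - exp (- y\<^sup>2)\<bar>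
    \<le> 256 * exp 1 * (\<bar>s - 1\<bar> + \<bar>m\<bar>) * exp (- y\<^sup>2 / 16)"
proof -
  define d where "d = \<bar>s - 1\<bar> + \<bar>m\<bar>"
  have s: "1/2 \<le> s" "s \<le> 3/2" using assms(1) by linarith+
  have half: "a / s \<le> 2 * a" if "a \<ge> 0" for a
    using s that frac_le[of a a "1/2" s] by simp
  have d: "\<bar>s - 1\<bar> \<le> d" "\<bar>m\<bar> \<le> d" "d \<ge> 0" by (auto simp: d_def)
  define z where "z = (y - m) / s"
  have z2: "z\<^sup>2 = (y - m)\<^sup>2 / s\<^sup>2" by (simp add: z_def power_divide)
  \<comment> \<open>Completing the square: (y - m)^2 = y^2 / 2 - m^2 + (y - 2 m)^2 / 2. So the
    shifted and rescaled Gaussian still decays like exp (- y^2 / 8).\<close>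
  have "y\<^sup>2 / 2 - 1 \<le> (y - m)\<^sup>2"
  proof -
    have "0 \<le> (y - 2 * m)\<^sup>2" by simp
    moreover have "m\<^sup>2 \<le> 1" using assms(2) by (simp add: abs_square_le_1)
    ultimately show ?thesis by (simp add: power2_eq_square algebra_simps)
  qed
  also have "\<dots> = s\<^sup>2 * z\<^sup>2" using s by (simp add: z2)
  also have "\<dots> \<le> 4 * z\<^sup>2"
    using s power_mono[of s 2 2] by (intro mult_right_mono) auto
  finally have za: "- z\<^sup>2 \<le> 1 - y\<^sup>2 / 8" by simp
  have zy: "\<bar>z - y\<bar> \<le> 2 * (1 + \<bar>y\<bar>) * d"
  proof -
    have "z - y = (y * (1 - s) - m) / s" using s by (simp add: z_def field_simps)
    hence "\<bar>z - y\<bar> = \<bar>y * (1 - s) - m\<bar> / s" using s by (simp add: abs_divide)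
    also have "\<dots> \<le> 2 * \<bar>y * (1 - s) - m\<bar>" by (simp add: half)
    also have "\<bar>y * (1 - s) - m\<bar> \<le> \<bar>y\<bar> * \<bar>s - 1\<bar> + \<bar>m\<bar>"
      by (metis abs_minus_commute abs_mult abs_triangle_ineq4)
    also have "\<dots> \<le> \<bar>y\<bar> * d + d" using d by (intro add_mono mult_left_mono) auto
    finally show ?thesis by (simp add: algebra_simps)
  qed
  have zy': "\<bar>z + y\<bar> \<le> 3 * (1 + \<bar>y\<bar>)"
  proof -
    have "\<bar>z\<bar> = \<bar>y - m\<bar> / s" using s by (simp add: z_def abs_divide)
    also have "\<dots> \<le> 2 * \<bar>y - m\<bar>" by (simp add: half)
    also have "\<dots> \<le> 2 * (\<bar>y\<bar> + \<bar>m\<bar>)" by (intro mult_left_mono abs_triangle_ineq4) simp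
    finally have "\<bar>z\<bar> + \<bar>y\<bar> \<le> 3 * (1 + \<bar>y\<bar>)" using assms(2) by simp
    thus ?thesis by (rule order_trans[OF abs_triangle_ineq])
  qed
  \<comment> \<open>Both exponents lie below 1 - y^2 / 8, which preserves the decay, while their
    difference factors into (z - y) (z + y) with first factor O(d).\<close>
  have "- y\<^sup>2 \<le> 1 - y\<^sup>2 / 8" using zero_le_power2[of y] by linarith
  hence "\<bar>exp (- z\<^sup>2) - exp (- y\<^sup>2)\<bar> \<le> \<bar>- z\<^sup>2 - (- y\<^sup>2)\<bar> * exp (1 - y\<^sup>2 / 8)"
    using za by (intro exp_diff_le_max)
  also have "\<bar>- z\<^sup>2 - (- y\<^sup>2)\<bar> = \<bar>z - y\<bar> * \<bar>z + y\<bar>"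
    by (simp add: abs_mult[symmetric] power2_eq_square algebra_simps abs_minus_commute)
  also have "\<dots> \<le> (2 * (1 + \<bar>y\<bar>) * d) * (3 * (1 + \<bar>y\<bar>))"
    using zy zy' by (intro mult_mono) auto
  finally have 1: "\<bar>exp (- z\<^sup>2) - exp (- y\<^sup>2)\<bar> \<le> 6 * d * (1 + \<bar>y\<bar>)\<^sup>2 * exp (1 - y\<^sup>2 / 8)"
    by (simp add: power2_eq_square algebra_simps)
  have "1 / s - 1 = (1 - s) / s" using s by (simp add: field_simps)
  hence "\<bar>1 / s - 1\<bar> = \<bar>s - 1\<bar> / s" using s by (simp add: abs_divide abs_minus_commute)
  also have "\<dots> \<le> 2 * \<bar>s - 1\<bar>" by (simp add: half)
  also have "\<dots> \<le> 2 * d" using d(1) by simp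
  finally have "\<bar>1 / s - 1\<bar> \<le> 2 * d" .
  hence 2: "\<bar>(1 / s - 1) * exp (- z\<^sup>2)\<bar> \<le> (2 * d) * exp (1 - y\<^sup>2 / 8)"
    unfolding abs_mult using za by (intro mult_mono) auto
  \<comment> \<open>Half of the decay exp (- y^2 / 8) is given up to absorb the quadratic factor.
    The sum 2 + 6 * 32 = 194 is rounded up to 256 below.\<close>
  have y: "(1 + \<bar>y\<bar>)\<^sup>2 \<le> 32 * exp (y\<^sup>2 / 16)"
  proof -
    have "0 \<le> (1 - \<bar>y\<bar>)\<^sup>2" by simp
    hence "(1 + \<bar>y\<bar>)\<^sup>2 \<le> 2 + 2 * y\<^sup>2" by (simp add: power2_eq_square algebra_simps)
    also have "\<dots> \<le> 32 * (1 + y\<^sup>2 / 16)" by simp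
    also have "\<dots> \<le> 32 * exp (y\<^sup>2 / 16)" using exp_ge_add_one_self by (intro mult_left_mono) auto
    finally show ?thesis .
  qed
  have "1 / s * exp (- z\<^sup>2) - exp (- y\<^sup>2) = (1 / s - 1) * exp (- z\<^sup>2) + (exp (- z\<^sup>2) - exp (- y\<^sup>2))"
    by (simp add: algebra_simps)
  hence "\<bar>1 / s * exp (- z\<^sup>2) - exp (- y\<^sup>2)\<bar> \<le> (2 * d) * exp (1 - y\<^sup>2 / 8) + 6 * d * (1 + \<bar>y\<bar>)\<^sup>2 * exp (1 - y\<^sup>2 / 8)"
    using 1 2 by linarith
  also have "\<dots> = (2 + 6 * (1 + \<bar>y\<bar>)\<^sup>2) * (d * exp (1 - y\<^sup>2 / 8))" by (simp add: algebra_simps)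
  also have "2 + 6 * (1 + \<bar>y\<bar>)\<^sup>2 \<le> 256 * exp (y\<^sup>2 / 16)"
  proof -
    have "1 \<le> exp (y\<^sup>2 / 16)" by simp
    thus ?thesis using y by linarith
  qed
  hence "(2 + 6 * (1 + \<bar>y\<bar>)\<^sup>2) * (d * exp (1 - y\<^sup>2 / 8)) \<le> (256 * exp (y\<^sup>2 / 16)) * (d * exp (1 - y\<^sup>2 / 8))"
    using d by (intro mult_right_mono) auto
  also have "\<dots> = 256 * exp 1 * d * exp (- y\<^sup>2 / 16)"
    by (simp add: exp_diff exp_minus field_simps flip: exp_add)
  finally show ?thesis by (simp add: z2 d_def)
qed

text \<open>Integrates the pointwise bound; exp (- y^2 / 16) has mass \<open>sqrt pi * 4\<close>.
  The constant is uniform in \<open>s\<close> and \<open>m\<close>, so both may later move with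
  time.\<close>

lemma L1_norm_gaussian_diff:
  "\<exists>K\<ge>0. \<forall>s m. \<bar>s - 1\<bar> \<le> 1/2 \<longrightarrow> \<bar>m\<bar> \<le> 1 \<longrightarrow>
     L1_norm (\<lambda>y. 1 / s * exp (- ((y - m)\<^sup>2 / s\<^sup>2)) - (gauss y)\<^sup>2) \<le> K * (\<bar>s - 1\<bar> + \<bar>m\<bar>)"
proof (intro exI conjI allI impI)
  show "0 \<le> 256 * exp 1 * (sqrt pi * 4)" by simp
  fix s m :: real
  assume s: "\<bar>s - 1\<bar> \<le> 1/2" and m: "\<bar>m\<bar> \<le> 1"
  define d where "d = \<bar>s - 1\<bar> + \<bar>m\<bar>"
  have G: "has_bochner_integral lborel (\<lambda>y::real. 256 * exp 1 * d * exp (- y\<^sup>2 / 16))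
      (256 * exp 1 * d * (sqrt pi * 4))"
    using has_bochner_integral_exp_square[of 4 0] by (intro has_bochner_integral_mult_right) simp
  have "s > 0" using s by linarith
  hence "integrable lborel (\<lambda>y. 1 / s * exp (- ((y - m)\<^sup>2 / s\<^sup>2)) - (gauss y)\<^sup>2)"
    using has_bochner_integral_exp_square[of s m] has_bochner_integral_gauss_square
    by (intro Bochner_Integration.integrable_diff integrable_mult_right)
       (auto simp: has_bochner_integral_iff)
  hence "L1_norm (\<lambda>y. 1 / s * exp (- ((y - m)\<^sup>2 / s\<^sup>2)) - (gauss y)\<^sup>2)
      \<le> (\<integral>y. 256 * exp 1 * d * exp (- y\<^sup>2 / 16) \<partial>lborel)"
    unfolding L1_norm_def using G gaussian_pointwise_diff[OF s m]
    by (intro integral_mono) (auto simp: has_bochner_integral_iff gauss_square d_def)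
  also have "\<dots> = 256 * exp 1 * d * (sqrt pi * 4)"
    using G by (rule has_bochner_integral_integral_eq)
  finally show "L1_norm (\<lambda>y. 1 / s * exp (- ((y - m)\<^sup>2 / s\<^sup>2)) - (gauss y)\<^sup>2)
      \<le> 256 * exp 1 * (sqrt pi * 4) * (\<bar>s - 1\<bar> + \<bar>m\<bar>)"
    by (simp add: d_def algebra_simps)
qed

section \<open>Growth of the scale function\<close>

text \<open>Covers \<open>c1\<close> with \<open>C = c10 * c20\<close> and \<open>\<tau>\<close>
  with \<open>C = 0\<close>. Only positive times occur, where derivatives within the half-line are
  ordinary ones.\<close>

locale scale_ode =
  fixes lam C :: real and u u' :: "real \<Rightarrow> real"
  assumes lam: "lam > 0"
    and pos: "t > 0 \<Longrightarrow> u t > 0"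
    and deriv: "t > 0 \<Longrightarrow> (u has_real_derivative u' t) (at t)"
    and deriv2: "t > 0 \<Longrightarrow> (u' has_real_derivative 2 * lam / u t + C\<^sup>2 / u t ^ 3) (at t)"
begin

lemma u'_mono:
  assumes "0 < s" "s \<le> t"
  shows "u' s \<le> u' t"
proof (rule DERIV_nonneg_imp_nondecreasing[of s t u'])
  fix x assume "s \<le> x" "x \<le> t"
  hence "x > 0" using assms by simp
  moreover from this have "0 \<le> 2 * lam / u x + C\<^sup>2 / u x ^ 3" using lam pos[of x] by simp
  ultimately show "\<exists>y. (u' has_real_derivative y) (at x) \<and> 0 \<le> y" using deriv2 by blast
qed (use assms in simp)

lemma u_lower_bound:
  assumes "0 < s" "s \<le> t" "a \<le> u' s"
  shows "u s + a * (t - s) \<le> u t"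
proof -
  have "u s - a * s \<le> u t - a * t"
  proof (rule DERIV_nonneg_imp_nondecreasing[of s t "\<lambda>x. u x - a * x"])
    fix x assume x: "s \<le> x" "x \<le> t"
    have "((\<lambda>x. u x - a * x) has_real_derivative u' x - a) (at x)"
      using x assms by (auto intro!: derivative_eq_intros deriv)
    moreover have "u' x - a \<ge> 0" using u'_mono[of s x] x assms by simp
    ultimately show "\<exists>y. ((\<lambda>x. u x - a * x) has_real_derivative y) (at x) \<and> 0 \<le> y" by blast
  qed (use assms in simp)
  thus ?thesis by (simp add: algebra_simps)
qed

text \<open>If \<open>u'\<close> stayed nonpositive, \<open>u\<close> would be bounded, hence \<open>u''\<close> bounded below by a positive
  constant.\<close>

lemma u'_eventually_pos: "\<exists>s>0. u' s > 0"
proof (rule ccontr)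
  assume "\<not> ?thesis"
  hence neg: "u' s \<le> 0" if "s > 0" for s using that by force
  have u1: "u t \<le> u 1" if "1 \<le> t" for t
  proof (rule DERIV_nonpos_imp_nonincreasing[of 1 t u])
    fix x :: real assume "1 \<le> x" "x \<le> t"
    thus "\<exists>y. (u has_real_derivative y) (at x) \<and> y \<le> 0"
      using neg deriv by (intro exI[of _ "u' x"]) auto
  qed (use that in simp)
  define a where "a = 2 * lam / u 1"
  have a: "a > 0" using lam pos by (simp add: a_def)
  have lin: "u' 1 - a * 1 \<le> u' t - a * t" if "1 \<le> t" for t
  proof (rule DERIV_nonneg_imp_nondecreasing[of 1 t "\<lambda>x. u' x - a * x"])
    fix x assume x: "1 \<le> x" "x \<le> t"
    have "((\<lambda>x. u' x - a * x) has_real_derivative 2 * lam / u x + C\<^sup>2 / u x ^ 3 - a) (at x)"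
      using x by (auto intro!: derivative_eq_intros deriv2)
    moreover have "a \<le> 2 * lam / u x"
      unfolding a_def using x u1[of x] pos[of x] lam by (intro divide_left_mono) auto
    moreover have "0 \<le> C\<^sup>2 / u x ^ 3" using pos[of x] x by simp
    ultimately show "\<exists>y. ((\<lambda>x. u' x - a * x) has_real_derivative y) (at x) \<and> 0 \<le> y" by fastforce
  qed (use that in simp)
  \<comment> \<open>With this time, \<open>lin\<close> gives u' t >= u' 1 + a (t - 1) = u' 1 + |u'
    1| + a > 0.\<close>
  define t where "t = 2 + \<bar>u' 1\<bar> / a"
  have "t \<ge> 1" using a by (simp add: t_def)
  moreover have "a * t = 2 * a + \<bar>u' 1\<bar>" using a by (simp add: t_def field_simps)
  ultimately have "u' t > 0" using lin[of t] a by linarith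
  thus False using neg[of t] \<open>t \<ge> 1\<close> by simp
qed

lemma u_at_top: "filterlim u at_top at_top"
proof -
  obtain s where s: "s > 0" "u' s > 0" using u'_eventually_pos by blast
  have "filterlim (\<lambda>t. u s + u' s * (t - s)) at_top at_top" using s by real_asymp
  moreover have "\<forall>\<^sub>F t in at_top. u s + u' s * (t - s) \<le> u t"
    using eventually_ge_at_top[of s] by eventually_elim (use s u_lower_bound in auto)
  ultimately show ?thesis by (rule filterlim_at_top_mono)
qed

text \<open>Multiplying the equation by 2 u' makes both sides exact derivatives. The initial data
  survive only in \<open>K\<close>, negligible against 4 lam ln u.\<close>

lemma energy: "\<exists>K. \<forall>t>0. (u' t)\<^sup>2 = 4 * lam * ln (u t) - C\<^sup>2 / (u t)\<^sup>2 + K"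
proof -
  have "((\<lambda>t. (u' t)\<^sup>2 - 4 * lam * ln (u t) + C\<^sup>2 / (u t)\<^sup>2) has_real_derivative 0) (at t within {0<..})"
    if "t \<in> {0<..}" for t
  proof -
    have t: "t > 0" "u t > 0" using that pos by auto
    have "((\<lambda>t. (u' t)\<^sup>2 - 4 * lam * ln (u t) + C\<^sup>2 / (u t)\<^sup>2) has_real_derivative
       2 * u' t * (2 * lam / u t + C\<^sup>2 / u t ^ 3) - 4 * lam * (u' t / u t) - C\<^sup>2 * (2 * u t * u' t) / ((u t)\<^sup>2 * (u t)\<^sup>2)) (at t)"
      using t by (auto intro!: derivative_eq_intros deriv deriv2 simp: mult_ac)
    moreover have "2 * u' t * (2 * lam / u t + C\<^sup>2 / u t ^ 3) - 4 * lam * (u' t / u t) - C\<^sup>2 * (2 * u t * u' t) / ((u t)\<^sup>2 * (u t)\<^sup>2) = 0"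
      using t by (simp add: field_simps power2_eq_square power3_eq_cube)
    ultimately show ?thesis by (metis has_field_derivative_at_within)
  qed
  hence "\<exists>K. \<forall>t\<in>{0<..}. (u' t)\<^sup>2 - 4 * lam * ln (u t) + C\<^sup>2 / (u t)\<^sup>2 = K"
    by (intro has_field_derivative_zero_constant convex_real_interval)
  then obtain K where "\<forall>t\<in>{0<..}. (u' t)\<^sup>2 - 4 * lam * ln (u t) + C\<^sup>2 / (u t)\<^sup>2 = K"
    by blast
  thus ?thesis by (intro exI[of _ K]) (auto simp: algebra_simps)
qed

text \<open>Since ln (u t) tends to infinity, the energy identity drives u' up to 2. The crude bound
  on \<open>u\<close> allows errors in 1 / ln (u t) to be replaced by errors in 1 / ln t.\<close>

lemma u_ge_t: "\<forall>\<^sub>F t in at_top. u t \<ge> t \<and> u' t > 0"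
proof -
  obtain K where K: "\<And>t. t > 0 \<Longrightarrow> (u' t)\<^sup>2 = 4 * lam * ln (u t) - C\<^sup>2 / (u t)\<^sup>2 + K"
    using energy by blast
  obtain s where s: "s > 0" "u' s > 0" using u'_eventually_pos by blast
  have "\<forall>\<^sub>F z::real in at_top. 4 * lam * ln z - C\<^sup>2 / z\<^sup>2 + K \<ge> 4" using lam by real_asymp
  hence "\<forall>\<^sub>F t in at_top. 4 * lam * ln (u t) - C\<^sup>2 / (u t)\<^sup>2 + K \<ge> 4"
    using u_at_top by (rule eventually_compose_filterlim)
  hence "\<forall>\<^sub>F t in at_top. (u' t)\<^sup>2 \<ge> 2\<^sup>2 \<and> t \<ge> s"
    using eventually_ge_at_top[of s] by eventually_elim (use s K in auto)
  then obtain r where r: "(u' r)\<^sup>2 \<ge> 2\<^sup>2" "r \<ge> s"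
    by (auto simp: eventually_at_top_linorder)
  \<comment> \<open>The energy identity sees only the square; the sign comes from monotonicity after
    \<open>s\<close>.\<close>
  have r': "u' r \<ge> 2" using r s u'_mono[of s r] by (intro power2_le_imp_le[of 2 "u' r"]) auto
  \<comment> \<open>A line of slope 2 that is positive at \<open>r\<close> lies above the diagonal
    from 2 r on.\<close>
  show ?thesis using eventually_ge_at_top[of "2 * r"]
  proof eventually_elim
    case (elim t)
    have "u r + 2 * (t - r) \<le> u t" using r' r s elim by (intro u_lower_bound) auto
    moreover have "u' t > 0" using u'_mono[of r t] r' r s elim by simp
    ultimately show ?case using elim pos[of r] r s by auto
  qed
qed

text \<open>By the energy identity \<open>u' \<approx> 2 \<surd>(lam ln u)\<close>, so \<open>u / (2 \<surd>(lam ln u))\<close> grows with slope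
  \<open>1 + O(1 / ln t)\<close>.\<close>

definition G where "G t = u t / (2 * sqrt (lam * ln (u t)))"

lemma G_deriv:
  "\<exists>M>0. \<forall>\<^sub>F t in at_top. \<exists>D. (G has_real_derivative D) (at t) \<and> \<bar>D - 1\<bar> \<le> M / ln t"
proof -
  obtain K where K: "\<And>t. t > 0 \<Longrightarrow> (u' t)\<^sup>2 = 4 * lam * ln (u t) - C\<^sup>2 / (u t)\<^sup>2 + K"
    using energy by blast
  \<comment> \<open>The quotient bounds the contribution of the energy constants; the extra 1
    absorbs the term 1 / (2 L) that comes from differentiating the denominator of
    \<open>G\<close>.\<close>
  define M where "M = (\<bar>K\<bar> + C\<^sup>2) / (4 * lam) + 1"
  have "M > 0" using lam by (auto simp: M_def intro!: add_nonneg_pos)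
  moreover have "\<forall>\<^sub>F t in at_top. \<exists>D. (G has_real_derivative D) (at t) \<and> \<bar>D - 1\<bar> \<le> M / ln t"
    using u_ge_t eventually_ge_at_top[of "exp 1"]
  proof eventually_elim
    case (elim t)
    have t: "t > 0" "1 \<le> ln t" using elim ln_ge_iff[of t 1] exp_gt_zero[of "1::real"] by linarith+
    have u: "ln t \<le> ln (u t)" "u t > 0" using elim t by auto
    define L where "L = ln (u t)"
    have L: "L \<ge> 1" "ln t \<le> L" unfolding L_def using u(1) t(2) by linarith+
    have u1: "u t \<ge> 1" using L u by (simp add: L_def) (metis dual_order.trans ln_ge_zero_iff zero_le_one)
    define y where "y = 2 * sqrt (lam * L)"
    have y: "y > 0" "y\<^sup>2 = 4 * lam * L" using L lam by (auto simp: y_def power_mult_distrib)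
    \<comment> \<open>With y^2 = 4 lam L the quotient rule collapses to this product: u' / y is
      close to 1 by energy, the other factor reflects the slow growth of \<open>y\<close>.\<close>
    define D where "D = u' t / y * (1 - 1 / (2 * L))"
    have "((\<lambda>t. lam * ln (u t)) has_real_derivative lam * (u' t / u t)) (at t)"
      by (rule DERIV_cong[OF DERIV_cmult[OF DERIV_chain2[OF DERIV_ln_divide[OF u(2)] deriv[OF t(1)]]]]) simp
    moreover have "lam * ln (u t) > 0" using L lam by (simp add: L_def)
    ultimately have "((\<lambda>t. 2 * sqrt (lam * ln (u t))) has_real_derivative
        2 * (inverse (sqrt (lam * ln (u t))) / 2 * (lam * (u' t / u t)))) (at t)"
      by (rule_tac DERIV_cmult, rule_tac DERIV_chain2[OF DERIV_real_sqrt])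
    hence "(G has_real_derivative
       (u' t * (2 * sqrt (lam * L)) - u t * (2 * (inverse (sqrt (lam * L)) / 2 * (lam * (u' t / u t))))) / (2 * sqrt (lam * L) * (2 * sqrt (lam * L)))) (at t)"
      unfolding G_def[abs_def] L_def using L lam t by (intro DERIV_divide deriv) (auto simp: L_def)
    also have "(u' t * (2 * sqrt (lam * L)) - u t * (2 * (inverse (sqrt (lam * L)) / 2 * (lam * (u' t / u t))))) / (2 * sqrt (lam * L) * (2 * sqrt (lam * L)))
       = (u' t * y - 2 * lam * u' t / y) / (y * y)"
      using u y by (simp add: y_def field_simps)
    also have "\<dots> = u' t / y * (1 - 2 * lam / y\<^sup>2)" using y(1) by (simp add: field_simps power2_eq_square)
    also have "\<dots> = D" using lam L by (simp add: D_def y(2) field_simps)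
    finally have GD: "(G has_real_derivative D) (at t)" .
    \<comment> \<open>As u' / y + 1 >= 1, the square is at least as far from 1, and the energy
      identity describes the square directly: its leading term is y^2.\<close>
    have "\<bar>u' t / y - 1\<bar> \<le> \<bar>(u' t / y)\<^sup>2 - 1\<bar>"
    proof -
      have "(u' t / y)\<^sup>2 - 1 = (u' t / y - 1) * (u' t / y + 1)" by (simp add: power2_eq_square algebra_simps)
      moreover have "\<bar>u' t / y - 1\<bar> * 1 \<le> \<bar>u' t / y - 1\<bar> * \<bar>u' t / y + 1\<bar>"
        using elim y by (intro mult_left_mono) auto
      ultimately show ?thesis by (simp add: abs_mult)
    qed
    also have "(u' t / y)\<^sup>2 - 1 = (K - C\<^sup>2 / (u t)\<^sup>2) / (4 * lam * L)"
      using K[OF t(1)] y L lam by (simp add: power_divide L_def[symmetric] field_simps)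
    also have "\<bar>\<dots>\<bar> \<le> (\<bar>K\<bar> + C\<^sup>2) / (4 * lam * L)"
    proof -
      have "\<bar>K - C\<^sup>2 / (u t)\<^sup>2\<bar> \<le> \<bar>K\<bar> + C\<^sup>2 / (u t)\<^sup>2"
        using abs_triangle_ineq4[of K "C\<^sup>2 / (u t)\<^sup>2"] by simp
      also have "C\<^sup>2 / (u t)\<^sup>2 \<le> C\<^sup>2" using u1 by (simp add: divide_le_eq mult_left_le_one_le mult_le_cancel_left1)
      finally show ?thesis using L lam by (simp add: abs_divide divide_right_mono)
    qed
    finally have A: "\<bar>u' t / y - 1\<bar> \<le> (M - 1) / L" by (simp add: M_def)
    have "r * (1 - e) - 1 = (r - 1) * (1 - e) - e" for r e :: real by (simp add: algebra_simps)
    hence "D - 1 = (u' t / y - 1) * (1 - 1 / (2 * L)) - 1 / (2 * L)" unfolding D_def .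
    hence "\<bar>D - 1\<bar> \<le> \<bar>u' t / y - 1\<bar> * \<bar>1 - 1 / (2 * L)\<bar> + \<bar>1 / (2 * L)\<bar>"
      by (metis abs_mult abs_triangle_ineq4)
    also have "\<dots> \<le> \<bar>u' t / y - 1\<bar> * 1 + 1 / L"
      using L by (intro add_mono mult_left_mono) (auto simp: field_simps)
    also have "\<dots> \<le> M / L" using A by (simp add: diff_divide_distrib)
    also have "\<dots> \<le> M / ln t" using \<open>M > 0\<close> L t by (intro divide_left_mono mult_pos_pos) linarith+
    finally show ?case using GD by blast
  qed
  ultimately show ?thesis by blast
qed

text \<open>Integrating the slope 1 + O(1 / ln t) costs an error O(t / ln t). No integral is formed:
  \<open>Q\<close> plus and minus \<open>G t - t\<close> are both nondecreasing.\<close>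

lemma G_asymp: "\<exists>M. \<forall>\<^sub>F t in at_top. \<bar>G t / t - 1\<bar> \<le> M / ln t"
proof -
  obtain M where M: "M > 0" and ev: "\<forall>\<^sub>F t in at_top. \<exists>D. (G has_real_derivative D) (at t) \<and> \<bar>D - 1\<bar> \<le> M / ln t"
    using G_deriv by blast
  have "\<forall>\<^sub>F t in at_top. (\<exists>D. (G has_real_derivative D) (at t) \<and> \<bar>D - 1\<bar> \<le> M / ln t) \<and> exp 2 \<le> t"
    using ev eventually_ge_at_top by (rule eventually_conj)
  then obtain s where s: "\<And>t. t \<ge> s \<Longrightarrow> (\<exists>D. (G has_real_derivative D) (at t) \<and> \<bar>D - 1\<bar> \<le> M / ln t) \<and> exp 2 \<le> t"
    by (auto simp: eventually_at_top_linorder)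
  \<comment> \<open>An explicit majorant of the integral of M / ln t: its derivative 2 M / ln t - 2
    M / (ln t)^2 is at least M / ln t once ln t >= 2, hence the threshold
    \<open>exp 2\<close>.\<close>
  define Q where "Q = (\<lambda>t. 2 * M * t / ln t)"
  have Q: "\<exists>D'. (Q has_real_derivative D') (at t) \<and> M / ln t \<le> D'" if "t \<ge> s" for t
  proof -
    have t: "t > 0" "2 \<le> ln t" using s[OF that] ln_ge_iff[of t 2] exp_gt_zero[of "2::real"] by linarith+
    have "t \<noteq> 1" using t by auto
    have "(Q has_real_derivative (2 * M * ln t - 2 * M * t * (1 / t)) / (ln t * ln t)) (at t)"
      unfolding Q_def using t \<open>t \<noteq> 1\<close> by (auto intro!: derivative_eq_intros)
    moreover have "M / ln t \<le> (2 * M * ln t - 2 * M * t * (1 / t)) / (ln t * ln t)"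
    proof -
      have "M / ln t = M * ln t / (ln t * ln t)" using t by simp
      also have "M * 2 \<le> M * ln t" using M t by (intro mult_left_mono) auto
      hence "M * ln t / (ln t * ln t) \<le> (2 * M * ln t - 2 * M * t * (1 / t)) / (ln t * ln t)"
        using t by (intro divide_right_mono) auto
      finally show ?thesis .
    qed
    ultimately show ?thesis by blast
  qed
  have 1: "Q s - (G s - s) \<le> Q t - (G t - t)" if "t \<ge> s" for t
  proof (rule DERIV_nonneg_imp_nondecreasing[of s t "\<lambda>t. Q t - (G t - t)"])
    fix x assume "s \<le> x" "x \<le> t"
    then obtain D D' where "(G has_real_derivative D) (at x)" "\<bar>D - 1\<bar> \<le> M / ln x"
      "(Q has_real_derivative D') (at x)" "M / ln x \<le> D'" using s Q by blast
    thus "\<exists>y. ((\<lambda>t. Q t - (G t - t)) has_real_derivative y) (at x) \<and> 0 \<le> y"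
      by (intro exI[of _ "D' - (D - 1)"]) (auto intro!: derivative_eq_intros)
  qed (use that in simp)
  have 2: "Q s + (G s - s) \<le> Q t + (G t - t)" if "t \<ge> s" for t
  proof (rule DERIV_nonneg_imp_nondecreasing[of s t "\<lambda>t. Q t + (G t - t)"])
    fix x assume "s \<le> x" "x \<le> t"
    then obtain D D' where "(G has_real_derivative D) (at x)" "\<bar>D - 1\<bar> \<le> M / ln x"
      "(Q has_real_derivative D') (at x)" "M / ln x \<le> D'" using s Q by blast
    thus "\<exists>y. ((\<lambda>t. Q t + (G t - t)) has_real_derivative y) (at x) \<and> 0 \<le> y"
      by (intro exI[of _ "D' + (D - 1)"]) (auto intro!: derivative_eq_intros)
  qed (use that in simp)
  \<comment> \<open>Collects the values at the starting time. It is eventually below t / ln t, which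
    accounts for the 1 in \<open>2 * M + 1\<close>.\<close>
  define c where "c = \<bar>Q s\<bar> + \<bar>G s - s\<bar>"
  have "\<forall>\<^sub>F t::real in at_top. c \<le> t / ln t" by real_asymp
  hence "\<forall>\<^sub>F t in at_top. \<bar>G t / t - 1\<bar> \<le> (2 * M + 1) / ln t"
    using eventually_ge_at_top[of s]
  proof eventually_elim
    case (elim t)
    have t: "t > 0" using s[of t] elim exp_gt_zero[of "2::real"] by linarith
    have "\<bar>G t - t\<bar> \<le> Q t + c" using 1[of t] 2[of t] elim by (auto simp: c_def)
    also have "\<dots> \<le> (2 * M + 1) / ln t * t" using elim(1) by (simp add: Q_def field_simps add_divide_distrib)
    finally have "\<bar>G t - t\<bar> / t \<le> (2 * M + 1) / ln t" using t by (simp add: divide_le_eq)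
    moreover have "G t / t - 1 = (G t - t) / t" using t by (simp add: field_simps)
    hence "\<bar>G t / t - 1\<bar> = \<bar>G t - t\<bar> / t" using t by (simp add: abs_divide)
    ultimately show ?case by simp
  qed
  thus ?thesis by blast
qed

text \<open>This is the logarithm of G t / t = 1 + O(1 / ln t). The terms subtracted from ln u - ln
  (ln u) / 2 involve only \<open>lam\<close> and \<open>t\<close>; \<open>C\<close> and the initial
  data affect only \<open>M\<close>.\<close>

lemma ln_u_asymp:
  "\<exists>M. \<forall>\<^sub>F t in at_top. \<bar>ln (u t) - ln (ln (u t)) / 2 - ln (2 * sqrt lam) - ln t\<bar> \<le> M / ln t"
proof -
  obtain M where ev: "\<forall>\<^sub>F t in at_top. \<bar>G t / t - 1\<bar> \<le> M / ln t" using G_asymp by blast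
  have "\<forall>\<^sub>F t::real in at_top. M / ln t \<le> 1 / 2" by real_asymp
  hence "\<forall>\<^sub>F t in at_top. \<bar>ln (u t) - ln (ln (u t)) / 2 - ln (2 * sqrt lam) - ln t\<bar> \<le> 2 * M / ln t"
    using ev u_ge_t eventually_ge_at_top[of "exp 1"]
  proof eventually_elim
    case (elim t)
    have t: "t > 0" "1 \<le> ln t" using elim ln_ge_iff[of t 1] exp_gt_zero[of "1::real"] by linarith+
    have u: "ln t \<le> ln (u t)" "u t > 0" using elim t by auto
    hence L: "ln (u t) > 0" using t(2) by linarith
    define z where "z = G t / t - 1"
    have z: "\<bar>z\<bar> \<le> M / ln t" "\<bar>z\<bar> \<le> 1/2" unfolding z_def using elim(1,2) by linarith+
    have "\<bar>ln (1 + z)\<bar> \<le> 2 * \<bar>z\<bar>"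
    proof -
      have "\<bar>ln (1 + z) - z\<bar> \<le> 2 * z\<^sup>2" using z by (intro abs_ln_one_plus_x_minus_x_bound) auto
      have a: "ln (1 + z) \<le> z" using z by (intro ln_add_one_self_le_self2) auto
      \<comment> \<open>For the lower bound, ln (1 + w) <= w is applied to the reciprocal, with w =
        - z / (1 + z) and 1 + z >= 1/2.\<close>
      have "- ln (1 + z) = ln (1 + (- z / (1 + z)))"
        using z by (subst ln_inverse[symmetric]) (auto simp: field_simps intro!: arg_cong[of _ _ ln])
      also have "\<dots> \<le> - z / (1 + z)" using z by (intro ln_add_one_self_le_self2) (auto simp: field_simps)
      also have "\<dots> \<le> \<bar>z\<bar> / (1/2)" using z by (intro frac_le) auto
      finally show ?thesis using a by auto
    qed
    moreover have "ln (1 + z) = ln (u t) - ln (ln (u t)) / 2 - ln (2 * sqrt lam) - ln t"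
      using u t L lam
      by (simp add: z_def G_def ln_div ln_mult ln_sqrt real_sqrt_mult add_divide_distrib)
    ultimately show ?case using z by simp
  qed
  thus ?thesis by blast
qed

text \<open>Makes the rescaled centre decay. Eventually G t >= t / 2, that is u t >= t sqrt (lam ln
  (u t)), and ln (u t) >= ln t.\<close>

lemma u_lower_asymp: "\<exists>a>0. \<forall>\<^sub>F t in at_top. u t \<ge> a * t * sqrt (ln t)"
proof -
  obtain M where ev: "\<forall>\<^sub>F t in at_top. \<bar>G t / t - 1\<bar> \<le> M / ln t" using G_asymp by blast
  have "\<forall>\<^sub>F t::real in at_top. M / ln t \<le> 1 / 2" by real_asymp
  hence "\<forall>\<^sub>F t in at_top. u t \<ge> sqrt lam * t * sqrt (ln t)"
    using ev u_ge_t eventually_ge_at_top[of "exp 1"]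
  proof eventually_elim
    case (elim t)
    have t: "t > 0" "1 \<le> ln t" using elim ln_ge_iff[of t 1] exp_gt_zero[of "1::real"] by linarith+
    have u: "ln t \<le> ln (u t)" "u t > 0" using elim t by auto
    have "1/2 \<le> G t / t" using elim by linarith
    hence "t / 2 \<le> G t" using t by (simp add: field_simps)
    moreover have "ln (u t) > 0" using u(1) t(2) by linarith
    hence "sqrt (lam * ln (u t)) > 0" using lam by simp
    ultimately have "t / 2 * (2 * sqrt (lam * ln (u t))) \<le> u t"
      by (subst (asm) G_def) (simp add: field_simps)
    moreover have "t * sqrt (lam * ln t) \<le> t * sqrt (lam * ln (u t))"
      using u t lam by (intro mult_left_mono) auto
    ultimately show ?case by (simp add: real_sqrt_mult mult_ac)
  qed
  thus ?thesis using lam by (intro exI[of _ "sqrt lam"]) auto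
qed

end

text \<open>The asymptotics of \<open>ln u - ln (ln u) / 2\<close> does not depend on the constants of the solution,
  and this expression determines \<open>ln u\<close> in a Lipschitz way.\<close>

lemma scale_ode_ratio:
  assumes "scale_ode lam C u u'" "scale_ode lam D v v'"
  shows "(\<lambda>t. u t / v t - 1) \<in> O(\<lambda>t. 1 / ln t)"
proof -
  interpret u: scale_ode lam C u u' by fact
  interpret v: scale_ode lam D v v' by fact
  obtain M where M: "\<forall>\<^sub>F t in at_top. \<bar>ln (u t) - ln (ln (u t)) / 2 - ln (2 * sqrt lam) - ln t\<bar> \<le> M / ln t"
    using u.ln_u_asymp by blast
  obtain N where N: "\<forall>\<^sub>F t in at_top. \<bar>ln (v t) - ln (ln (v t)) / 2 - ln (2 * sqrt lam) - ln t\<bar> \<le> N / ln t"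
    using v.ln_u_asymp by blast
  \<comment> \<open>Ensures |p - q| <= 1 below, where exp w - 1 is bounded by 2 |w|.\<close>
  have "\<forall>\<^sub>F t::real in at_top. 2 * (M + N) / ln t \<le> 1" by real_asymp
  hence "\<forall>\<^sub>F t in at_top. \<bar>u t / v t - 1\<bar> \<le> 4 * (M + N) * \<bar>1 / ln t\<bar>"
    using M N u.u_ge_t v.u_ge_t eventually_ge_at_top[of "exp 1"]
  proof eventually_elim
    case (elim t)
    have t: "t > 0" "1 \<le> ln t" using elim ln_ge_iff[of t 1] exp_gt_zero[of "1::real"] by linarith+
    have pos: "u t > 0" "v t > 0" using elim t by auto
    define p q where "p = ln (u t)" "q = ln (v t)"
    have "ln t \<le> p" "ln t \<le> q" using elim t pos by (auto simp: p_q_def)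
    hence pq: "p \<ge> 1" "q \<ge> 1" using t(2) by linarith+
    \<comment> \<open>On [1, \<infinity>) the logarithm is 1-Lipschitz; with its factor 1/2 the
      iterated logarithm can be absorbed into |p - q|.\<close>
    have lip: "\<bar>ln p - ln q\<bar> \<le> \<bar>p - q\<bar>"
    proof -
      have "ln a - ln b \<le> a - b" if "1 \<le> b" "b \<le> a" for a b :: real
      proof -
        have "ln a - ln b = ln (1 + (a - b) / b)" using that by (simp add: ln_div field_simps)
        also have "\<dots> \<le> (a - b) / b" using that by (intro ln_add_one_self_le_self) auto
        also have "\<dots> \<le> a - b" using that by (simp add: divide_le_eq mult_left_le_one_le mult_le_cancel_left1)
        finally show ?thesis .
      qed
      thus ?thesis using pq ln_mono[of p q] ln_mono[of q p] by (cases "p \<le> q") fastforce+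
    qed
    define c where "c = ln (2 * sqrt lam) + ln t"
    have "p - q - (ln p - ln q) / 2 = (p - ln p / 2 - c) - (q - ln q / 2 - c)"
      by (simp add: diff_divide_distrib)
    hence "\<bar>p - q - (ln p - ln q) / 2\<bar> \<le> \<bar>p - ln p / 2 - c\<bar> + \<bar>q - ln q / 2 - c\<bar>"
      by (simp only: abs_triangle_ineq4)
    also have "\<dots> \<le> M / ln t + N / ln t"
      using elim by (intro add_mono) (simp_all add: p_q_def c_def diff_diff_eq)
    finally have e: "\<bar>p - q - (ln p - ln q) / 2\<bar> \<le> M / ln t + N / ln t" .
    have "\<bar>p - q\<bar> \<le> \<bar>p - q - (ln p - ln q) / 2\<bar> + \<bar>(ln p - ln q) / 2\<bar>"
      by (rule order_trans[OF _ abs_triangle_ineq]) simp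
    also have "\<dots> \<le> (M / ln t + N / ln t) + \<bar>p - q\<bar> / 2"
      using e lip by (intro add_mono) auto
    finally have w: "\<bar>p - q\<bar> \<le> 2 * (M + N) / ln t" by (simp add: add_divide_distrib)
    have "u t / v t = exp (p - q)" using pos by (simp add: p_q_def exp_diff)
    hence "\<bar>u t / v t - 1\<bar> = \<bar>exp (p - q) - 1\<bar>" by simp
    also have "\<dots> \<le> 2 * \<bar>p - q\<bar>"
    proof -
      define w where "w = p - q"
      have "\<bar>w\<bar> \<le> 1" using \<open>\<bar>p - q\<bar> \<le> 2 * (M + N) / ln t\<close> elim(1) by (simp add: w_def)
      have lower: "1 + w \<le> exp w" by (rule exp_ge_add_one_self)
      have "\<bar>exp w - 1\<bar> \<le> 2 * \<bar>w\<bar>"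
      proof (cases "0 \<le> w")
        case True
        have "exp w \<le> 1 + w + w\<^sup>2" using True \<open>\<bar>w\<bar> \<le> 1\<close> by (intro exp_bound) auto
        moreover have "w\<^sup>2 \<le> w" using True \<open>\<bar>w\<bar> \<le> 1\<close> by (simp add: power2_eq_square mult_left_le)
        ultimately show ?thesis using True lower by linarith
      next
        case False
        hence "exp w \<le> 1" by simp
        thus ?thesis using False lower by linarith
      qed
      thus ?thesis by (simp add: w_def)
    qed
    also have "\<dots> \<le> 4 * (M + N) / ln t" using mult_left_mono[OF w, of 2] by simp
    finally show ?case using t by simp
  qed
  thus ?thesis by (intro bigoI[of _ "4 * (M + N)"]) auto
qed

section \<open>Calculus of \<open>C\<^sup>k\<close> functions\<close>

lemma Ck_on_Suc_continuous:
  assumes "Ck_on (Suc k) S f"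
  shows "continuous_on S f"
  using assms has_derivative_continuous
  unfolding Ck_on.simps continuous_on_eq_continuous_within by blast

lemma Ck_on_Suc_imp: "Ck_on (Suc k) S f \<Longrightarrow> Ck_on k S f"
proof (induction k arbitrary: f)
  case 0
  then show ?case by (auto dest: Ck_on_Suc_continuous simp del: Ck_on.simps(2))
next
  case (Suc k)
  then obtain f' where "\<forall>x\<in>S. (f has_derivative f' x) (at x within S)" "\<forall>v. Ck_on (Suc k) S (\<lambda>x. f' x v)"
    by (auto simp only: Ck_on.simps(2)[of "Suc k"])
  then show ?case using Suc.IH by auto
qed

lemma Ck_on_cong:
  assumes "\<And>x. x \<in> S \<Longrightarrow> f x = g x"
  shows "Ck_on k S f \<longleftrightarrow> Ck_on k S g"
proof (cases k)
  case 0
  then show ?thesis using assms by (simp cong: continuous_on_cong)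
next
  case (Suc k)
  have "(f has_derivative D) (at x within S) \<longleftrightarrow> (g has_derivative D) (at x within S)" if "x \<in> S" for x D
    using that assms has_derivative_transform by metis
  then show ?thesis by (auto simp: Suc)
qed

lemma Ck_on_const: "Ck_on k S (\<lambda>x. c)"
proof (induction k arbitrary: c)
  case (Suc k)
  then show ?case by (auto intro!: exI[of _ "\<lambda>x v. 0"])
qed auto

lemma Ck_on_bounded_linear:
  assumes "bounded_linear f"
  shows "Ck_on k S f"
proof (cases k)
  case 0
  then show ?thesis using assms by (auto intro: linear_continuous_on)
next
  case (Suc k)
  then show ?thesis using assms bounded_linear_imp_has_derivative[OF assms]
    by (auto intro!: exI[of _ "\<lambda>x. f"] Ck_on_const)
qed

lemma Ck_on_add:
  assumes "Ck_on k S f" "Ck_on k S g"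
  shows "Ck_on k S (\<lambda>x. f x + g x)"
  using assms
proof (induction k arbitrary: f g)
  case 0
  then show ?case by (auto intro: continuous_on_add)
next
  case (Suc k)
  then obtain f' g' where "\<forall>x\<in>S. (f has_derivative f' x) (at x within S)" "\<forall>v. Ck_on k S (\<lambda>x. f' x v)"
     "\<forall>x\<in>S. (g has_derivative g' x) (at x within S)" "\<forall>v. Ck_on k S (\<lambda>x. g' x v)"
    by auto
  then show ?case using Suc.IH
    by (auto intro!: exI[of _ "\<lambda>x v. f' x v + g' x v"] has_derivative_add)
qed

text \<open>The product rule contains \<open>f\<close> and \<open>g\<close> undifferentiated, so the
  induction also needs the descent \<open>Ck_on_Suc_imp\<close>.\<close>

lemma Ck_on_mult:
  fixes f g :: "'a::real_normed_vector \<Rightarrow> real"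
  assumes "Ck_on k S f" "Ck_on k S g"
  shows "Ck_on k S (\<lambda>x. f x * g x)"
  using assms
proof (induction k arbitrary: f g)
  case 0
  then show ?case by (auto intro: continuous_on_mult)
next
  case (Suc k)
  then obtain f' g' where "\<forall>x\<in>S. (f has_derivative f' x) (at x within S)" "\<forall>v. Ck_on k S (\<lambda>x. f' x v)"
     "\<forall>x\<in>S. (g has_derivative g' x) (at x within S)" "\<forall>v. Ck_on k S (\<lambda>x. g' x v)"
    by auto
  moreover have "Ck_on k S f" "Ck_on k S g" using Suc.prems by (auto dest: Ck_on_Suc_imp simp del: Ck_on.simps)
  ultimately show ?case using Suc.IH
    by (auto intro!: exI[of _ "\<lambda>x v. f x * g' x v + f' x v * g x"] has_derivative_mult Ck_on_add)
qed

lemma Ck_on_inverse: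
  fixes f :: "'a::real_normed_vector \<Rightarrow> real"
  assumes "Ck_on k S f" "\<And>x. x \<in> S \<Longrightarrow> f x \<noteq> 0"
  shows "Ck_on k S (\<lambda>x. inverse (f x))"
  using assms(1)
proof (induction k)
  case 0
  then show ?case using assms(2) by (auto intro: continuous_on_inverse)
next
  case (Suc k)
  then obtain f' where "\<forall>x\<in>S. (f has_derivative f' x) (at x within S)" "\<forall>v. Ck_on k S (\<lambda>x. f' x v)"
    by auto
  moreover have "Ck_on k S (\<lambda>x. inverse (f x))" using Suc by (auto dest: Ck_on_Suc_imp simp del: Ck_on.simps)
  moreover have "Ck_on k S (\<lambda>x. - inverse (f x) * g x * inverse (f x))" if "Ck_on k S g" for g
    using Ck_on_mult[OF Ck_on_mult[OF Ck_on_mult[OF Ck_on_const[of k S "-1"] calculation(3)] that] calculation(3)]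
    by simp
  ultimately show ?case using assms(2)
    by (auto intro!: exI[of _ "\<lambda>x v. - inverse (f x) * f' x v * inverse (f x)"] has_derivative_inverse)
qed

lemma Ck_on_SucI_real:
  fixes u :: "real \<Rightarrow> real"
  assumes "\<And>t. t \<in> I \<Longrightarrow> (u has_real_derivative u' t) (at t within I)" "Ck_on k I u'"
  shows "Ck_on (Suc k) I u"
  using assms
  by (auto simp: has_field_derivative_def mult.commute intro!: exI[of _ "\<lambda>t v. u' t * v"] Ck_on_mult Ck_on_const)

text \<open>Lifts functions of time to the strip on which smoothness of \<open>b2\<close> and
  \<open>c2\<close> is asserted.\<close>

lemma Ck_on_fst:
  fixes u :: "real \<Rightarrow> real"
  assumes "Ck_on k I u"
  shows "Ck_on k (I \<times> (UNIV :: real set)) (\<lambda>p. u (fst p))"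
  using assms
proof (induction k arbitrary: u)
  case 0
  then show ?case by (auto intro!: continuous_on_compose2[of I u] continuous_on_fst continuous_on_id)
next
  case (Suc k)
  then obtain u' where u': "\<forall>x\<in>I. (u has_derivative u' x) (at x within I)" "\<forall>v. Ck_on k I (\<lambda>x. u' x v)"
    by auto
  have "((\<lambda>p. u (fst p)) has_derivative (\<lambda>v. u' (fst p) (fst v))) (at p within I \<times> (UNIV :: real set))"
    if "p \<in> I \<times> (UNIV :: real set)" for p
    using that u'(1)
    by (intro has_derivative_in_compose2[of I u u', where f = fst and f' = fst])
       (auto intro: has_derivative_fst has_derivative_ident)
  then show ?case using Suc.IH u'(2)
    by (auto intro!: exI[of _ "\<lambda>p v. u' (fst p) (fst v)"])
qed

section \<open>The kinetic equation for Gaussians\<close>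

lemma real_derivative_transform:
  assumes "(f has_real_derivative D) (at t within I)" "t \<in> I" "\<And>s. s \<in> I \<Longrightarrow> g s = f s"
  shows "(g has_real_derivative D) (at t within I)"
  using assms has_derivative_transform[of t I g f] by (auto simp: has_field_derivative_def)

lemma Dt_eq:
  assumes "at t within I \<noteq> bot" "(c has_real_derivative D) (at t within I)"
  shows "Dt I c t = D"
  using assms vector_derivative_within
  by (simp add: Dt_def has_real_derivative_iff_has_vector_derivative)

lemma real_derivative_unique_within:
  assumes "at t within I \<noteq> bot" "(c has_real_derivative D) (at t within I)"
    "(c has_real_derivative E) (at t within I)"
  shows "D = E"
  using Dt_eq assms by metis

text \<open>A linear map on the line is its value at 1, and nontriviality of the filter identifies
  \<open>Dt I c\<close> with whatever derivative \<open>Ck_on\<close> provides.\<close>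

lemma Ck_on_SucD_real:
  fixes c :: "real \<Rightarrow> real"
  assumes "\<And>t. t \<in> I \<Longrightarrow> at t within I \<noteq> bot" "Ck_on (Suc k) I c"
  shows "\<And>t. t \<in> I \<Longrightarrow> (c has_real_derivative Dt I c t) (at t within I)" "Ck_on k I (Dt I c)"
proof -
  obtain c' where c': "\<forall>x\<in>I. (c has_derivative c' x) (at x within I)" "\<forall>v. Ck_on k I (\<lambda>x. c' x v)"
    using assms(2) by auto
  have d: "(c has_real_derivative c' t 1) (at t within I)" if "t \<in> I" for t
  proof -
    have "bounded_linear (c' t)" using that c'(1) has_derivative_bounded_linear by blast
    hence "c' t v = c' t 1 * v" for v
      using linear_cmul[OF bounded_linear.linear, of "c' t" v 1] by simp
    hence eq: "c' t = (*) (c' t 1)" by (rule ext)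
    show ?thesis
      using c'(1)[rule_format, OF that] unfolding has_field_derivative_def by (subst (asm) eq)
  qed
  hence e: "Dt I c t = c' t 1" if "t \<in> I" for t using that assms(1) Dt_eq by blast
  show "(c has_real_derivative Dt I c t) (at t within I)" if "t \<in> I" for t using d e that by simp
  show "Ck_on k I (Dt I c)" using c'(2) e Ck_on_cong[of I "Dt I c" "\<lambda>x. c' x 1"] by simp
qed

lemma partial_derivatives:
  fixes b :: "real \<Rightarrow> real \<Rightarrow> real"
  assumes "((\<lambda>(t, x). b t x) has_derivative D) (at (t, x) within I \<times> UNIV)" "t \<in> I"
  shows "((\<lambda>s. b s x) has_real_derivative D (1, 0)) (at t within I)"
    "((\<lambda>y. b t y) has_real_derivative D (0, 1)) (at x)"
proof -
  have lin: "linear D" using assms(1) has_derivative_bounded_linear bounded_linear.linear by blast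
  have "((\<lambda>s. (\<lambda>(t, x). b t x) (s, x)) has_derivative (\<lambda>h. D (h, 0))) (at t within I)"
  proof (rule has_derivative_in_compose[where f = "\<lambda>s. (s, x)" and f' = "\<lambda>h. (h, 0)"])
    show "((\<lambda>s. (s, x)) has_derivative (\<lambda>h. (h, 0))) (at t within I)"
      by (intro has_derivative_Pair has_derivative_ident has_derivative_const)
    show "((\<lambda>(t, x). b t x) has_derivative D) (at (t, x) within (\<lambda>s. (s, x)) ` I)"
      using assms by (rule_tac has_derivative_subset) auto
  qed
  moreover have "(\<lambda>h. D (h, 0)) = (*) (D (1, 0))"
  proof
    fix h :: real show "D (h, 0) = D (1, 0) * h" using linear_cmul[OF lin, of h "(1, 0)"] by simp
  qed
  ultimately show "((\<lambda>s. b s x) has_real_derivative D (1, 0)) (at t within I)"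
    by (simp add: has_field_derivative_def)
  have "((\<lambda>y. (\<lambda>(t, x). b t x) (t, y)) has_derivative (\<lambda>h. D (0, h))) (at x within UNIV)"
  proof (rule has_derivative_in_compose[where f = "\<lambda>y. (t, y)" and f' = "\<lambda>h. (0, h)"])
    show "((\<lambda>y. (t, y)) has_derivative (\<lambda>h. (0, h))) (at x within UNIV)"
      by (intro has_derivative_Pair has_derivative_ident has_derivative_const)
    show "((\<lambda>(t, x). b t x) has_derivative D) (at (t, x) within (\<lambda>y. (t, y)) ` UNIV)"
      using assms by (rule_tac has_derivative_subset) auto
  qed
  moreover have "(\<lambda>h. D (0, h)) = (*) (D (0, 1))"
  proof
    fix h :: real show "D (0, h) = D (0, 1) * h" using linear_cmul[OF lin, of h "(0, 1)"] by simp
  qed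
  ultimately show "((\<lambda>y. b t y) has_real_derivative D (0, 1)) (at x)"
    by (simp add: has_field_derivative_def)
qed

text \<open>The factor \<open>c2 t x\<close> from the integral cancels the normalization, so any
  x-dependence of \<open>b2\<close> and \<open>c2\<close> drops out. Hence the logarithm of the
  density is quadratic in x and the force linear.\<close>

lemma gaussian_ansatz_density:
  assumes "c1 t > 0" "c2 t x > 0"
  shows "has_bochner_integral lborel (gaussian_ansatz b1 c1 b2 c2 t x)
    (1 / (sqrt pi * c1 t) * exp (- ((x - b1 t)\<^sup>2 / (c1 t)\<^sup>2)))"
proof -
  have "has_bochner_integral lborel
     (\<lambda>\<xi>. (1 / (pi * c1 t * c2 t x) * exp (- ((x - b1 t)\<^sup>2 / (c1 t)\<^sup>2))) * exp (- ((\<xi> - b2 t x)\<^sup>2 / (c2 t x)\<^sup>2)))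
     ((1 / (pi * c1 t * c2 t x) * exp (- ((x - b1 t)\<^sup>2 / (c1 t)\<^sup>2))) * (sqrt pi * c2 t x))"
    using assms by (intro has_bochner_integral_mult_right has_bochner_integral_exp_square)
  moreover have "sqrt pi * sqrt pi = pi" by simp
  hence "(1 / (pi * c1 t * c2 t x) * exp (- ((x - b1 t)\<^sup>2 / (c1 t)\<^sup>2))) * (sqrt pi * c2 t x)
     = 1 / (sqrt pi * c1 t) * exp (- ((x - b1 t)\<^sup>2 / (c1 t)\<^sup>2))"
    using assms by (simp add: field_simps)
  ultimately show ?thesis
    by (simp add: gaussian_ansatz_def[abs_def] exp_diff exp_minus field_simps)
qed

lemma spatial_density_ansatz:
  assumes "c1 t > 0" "c2 t x > 0" "\<And>\<xi>. f t x \<xi> = gaussian_ansatz b1 c1 b2 c2 t x \<xi>"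
  shows "integrable lborel (f t x)"
    "spatial_density f t x = 1 / (sqrt pi * c1 t) * exp (- ((x - b1 t)\<^sup>2 / (c1 t)\<^sup>2))"
proof -
  have "f t x = gaussian_ansatz b1 c1 b2 c2 t x" using assms(3) by (rule ext)
  thus "integrable lborel (f t x)"
    "spatial_density f t x = 1 / (sqrt pi * c1 t) * exp (- ((x - b1 t)\<^sup>2 / (c1 t)\<^sup>2))"
    using gaussian_ansatz_density[of c1 t c2 x b1 b2, OF assms(1,2)]
    by (simp_all add: spatial_density_def has_bochner_integral_iff)
qed

lemma square_quotient_derivative:
  fixes X A :: "real \<Rightarrow> real"
  assumes "(X has_real_derivative X') (at t within S)" "(A has_real_derivative A') (at t within S)" "A t > 0"
  shows "((\<lambda>s. (X s)\<^sup>2 / (A s)\<^sup>2) has_real_derivative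
    2 * X t * X' / (A t)\<^sup>2 - 2 * (X t)\<^sup>2 * A' / (A t) ^ 3) (at t within S)"
proof -
  have "((\<lambda>s. (X s / A s)\<^sup>2) has_real_derivative
      of_nat 2 * ((X' * A t - X t * A') / (A t * A t) * (X t / A t) ^ (2 - Suc 0))) (at t within S)"
    using assms by (intro DERIV_power DERIV_divide) auto
  moreover have "of_nat 2 * ((X' * A t - X t * A') / (A t * A t) * (X t / A t) ^ (2 - Suc 0))
      = 2 * X t * X' / (A t)\<^sup>2 - 2 * (X t)\<^sup>2 * A' / (A t) ^ 3"
    using assms(3) by (simp add: field_simps power2_eq_square power3_eq_cube)
  ultimately show ?thesis by (simp add: power_divide)
qed

text \<open>One formula for all three partial derivatives: the variable may be time, position or
  velocity, with the remaining data constant. The bracket is the logarithmic derivative.\<close>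

lemma gaussian_profile_derivative:
  assumes "(A has_real_derivative A') (at t within S)" "(B has_real_derivative B') (at t within S)"
    "(X has_real_derivative X') (at t within S)" "(H has_real_derivative H') (at t within S)"
    "A t > 0" "B t > 0"
  shows "((\<lambda>s. 1 / (pi * A s * B s) * exp (- (\<bar>X s\<bar>\<^sup>2 / (A s)\<^sup>2) - \<bar>H s\<bar>\<^sup>2 / (B s)\<^sup>2)) has_real_derivative
    1 / (pi * A t * B t) * exp (- (\<bar>X t\<bar>\<^sup>2 / (A t)\<^sup>2) - \<bar>H t\<bar>\<^sup>2 / (B t)\<^sup>2) *
     (- A' / A t - B' / B t - 2 * X t * X' / (A t)\<^sup>2 + 2 * (X t)\<^sup>2 * A' / (A t) ^ 3
      - 2 * H t * H' / (B t)\<^sup>2 + 2 * (H t)\<^sup>2 * B' / (B t) ^ 3)) (at t within S)"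
proof -
  have E: "((\<lambda>s. - ((X s)\<^sup>2 / (A s)\<^sup>2) - (H s)\<^sup>2 / (B s)\<^sup>2) has_real_derivative
     (- 2 * X t * X' / (A t)\<^sup>2 + 2 * (X t)\<^sup>2 * A' / (A t) ^ 3
      - 2 * H t * H' / (B t)\<^sup>2 + 2 * (H t)\<^sup>2 * B' / (B t) ^ 3)) (at t within S)"
    by (rule DERIV_cong[OF DERIV_diff[OF DERIV_minus[OF square_quotient_derivative[OF assms(3,1,5)]]
          square_quotient_derivative[OF assms(4,2,6)]]]) simp
  have N: "((\<lambda>s. 1 / (pi * A s * B s)) has_real_derivative
     1 / (pi * A t * B t) * (- A' / A t - B' / B t)) (at t within S)"
    using assms(5,6)
    by (intro DERIV_cong[OF DERIV_divide[OF DERIV_const DERIV_mult[OF DERIV_cmult[OF assms(1)] assms(2)]]])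
       (simp_all add: field_simps)
  show ?thesis
    unfolding power2_abs
  proof (rule DERIV_cong[OF DERIV_mult[OF N DERIV_chain2[OF DERIV_exp E]]])
    have "K * n * e + (e * d) * K = K * e * (n + d)" for K n e d :: real by (simp add: algebra_simps)
    note this[of "1 / (pi * A t * B t)" "- A' / A t - B' / B t"]
    then show "1 / (pi * A t * B t) * (- A' / A t - B' / B t) * exp (- ((X t)\<^sup>2 / (A t)\<^sup>2) - (H t)\<^sup>2 / (B t)\<^sup>2)
        + exp (- ((X t)\<^sup>2 / (A t)\<^sup>2) - (H t)\<^sup>2 / (B t)\<^sup>2) *
          (- 2 * X t * X' / (A t)\<^sup>2 + 2 * (X t)\<^sup>2 * A' / (A t) ^ 3
           - 2 * H t * H' / (B t)\<^sup>2 + 2 * (H t)\<^sup>2 * B' / (B t) ^ 3) * (1 / (pi * A t * B t))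
      = 1 / (pi * A t * B t) * exp (- ((X t)\<^sup>2 / (A t)\<^sup>2) - (H t)\<^sup>2 / (B t)\<^sup>2) *
          (- A' / A t - B' / B t - 2 * X t * X' / (A t)\<^sup>2 + 2 * (X t)\<^sup>2 * A' / (A t) ^ 3
           - 2 * H t * H' / (B t)\<^sup>2 + 2 * (H t)\<^sup>2 * B' / (B t) ^ 3)"
      by (rule trans) (simp add: diff_divide_distrib)
  qed
qed

text \<open>The derivatives in the existential are unique, and those of \<open>f\<close> are
  \<open>f\<close> times polynomials in \<xi> - b2; as \<open>f\<close> is positive it divides out.
  Degree three arises only from \<xi> times the x-derivative of \<open>c2\<close>.\<close>

lemma ansatz_kinetic_iff:
  fixes b2 c2 :: "real \<Rightarrow> real \<Rightarrow> real"
  assumes t: "t \<in> I" "at t within I \<noteq> bot"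
    and c1: "(c1 has_real_derivative c1') (at t within I)" "c1 t > 0"
    and b1: "(b1 has_real_derivative b1') (at t within I)"
    and b2: "((\<lambda>s. b2 s x) has_real_derivative b2t) (at t within I)"
      "((\<lambda>y. b2 t y) has_real_derivative b2x) (at x)"
    and c2: "((\<lambda>s. c2 s x) has_real_derivative c2t) (at t within I)"
      "((\<lambda>y. c2 t y) has_real_derivative c2x) (at x)" "\<And>y. c2 t y > 0"
    and f: "\<And>s y \<eta>. s \<in> I \<Longrightarrow> f s y \<eta> = gaussian_ansatz b1 c1 b2 c2 s y \<eta>"
    and X: "X = x - b1 t"
    and p0: "p0 = - c1' / c1 t - c2t / c2 t x + 2 * X * b1' / (c1 t)\<^sup>2 + 2 * X\<^sup>2 * c1' / (c1 t) ^ 3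
        - b2 t x * (c2x / c2 t x + 2 * X / (c1 t)\<^sup>2)"
    and p1: "p1 = 2 * (b2t + b2 t x * b2x - 2 * lam * X / (c1 t)\<^sup>2) / (c2 t x)\<^sup>2
        - 2 * X / (c1 t)\<^sup>2 - c2x / c2 t x"
    and p2: "p2 = 2 * (c2t + b2 t x * c2x) / (c2 t x) ^ 3 + 2 * b2x / (c2 t x)\<^sup>2"
    and p3: "p3 = 2 * c2x / (c2 t x) ^ 3"
  shows "(\<exists>ft fx f\<xi> r.
        ((\<lambda>s. f s x \<xi>) has_real_derivative ft) (at t within I) \<and>
        ((\<lambda>y. f t y \<xi>) has_real_derivative fx) (at x) \<and>
        ((\<lambda>\<eta>. f t x \<eta>) has_real_derivative f\<xi>) (at \<xi>) \<and>
        ((\<lambda>y. ln (spatial_density f t y)) has_real_derivative r) (at x) \<and>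
        ft + \<xi> * fx - lam * r * f\<xi> = 0) \<longleftrightarrow>
    p0 + p1 * (\<xi> - b2 t x) + p2 * (\<xi> - b2 t x)\<^sup>2 + p3 * (\<xi> - b2 t x) ^ 3 = 0"
  (is "?E \<longleftrightarrow> ?p = 0")
proof -
  define F where "F = f t x \<xi>"
  define \<eta> where "\<eta> = \<xi> - b2 t x"
  have F: "F = 1 / (pi * c1 t * c2 t x) * exp (- (\<bar>x - b1 t\<bar>\<^sup>2 / (c1 t)\<^sup>2) - \<bar>\<xi> - b2 t x\<bar>\<^sup>2 / (c2 t x)\<^sup>2)"
    using f[OF t(1)] by (simp add: F_def gaussian_ansatz_def)
  have "F > 0" using c1 c2 by (simp add: F)
  \<comment> \<open>The zero terms and double signs in these three factors are kept so that they
    match the instances of \<open>gaussian_profile_derivative\<close> literally.\<close>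
  define At where "At = - c1' / c1 t - c2t / c2 t x - 2 * X * (- b1') / (c1 t)\<^sup>2 + 2 * X\<^sup>2 * c1' / (c1 t) ^ 3
      - 2 * \<eta> * (- b2t) / (c2 t x)\<^sup>2 + 2 * \<eta>\<^sup>2 * c2t / (c2 t x) ^ 3"
  define Ax where "Ax = - 0 / c1 t - c2x / c2 t x - 2 * X * 1 / (c1 t)\<^sup>2 + 2 * X\<^sup>2 * 0 / (c1 t) ^ 3
      - 2 * \<eta> * (- b2x) / (c2 t x)\<^sup>2 + 2 * \<eta>\<^sup>2 * c2x / (c2 t x) ^ 3"
  define A\<xi> where "A\<xi> = - 0 / c1 t - 0 / c2 t x - 2 * X * 0 / (c1 t)\<^sup>2 + 2 * X\<^sup>2 * 0 / (c1 t) ^ 3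
      - 2 * \<eta> * 1 / (c2 t x)\<^sup>2 + 2 * \<eta>\<^sup>2 * 0 / (c2 t x) ^ 3"
  have ft: "((\<lambda>s. f s x \<xi>) has_real_derivative F * At) (at t within I)"
  proof (rule real_derivative_transform[OF _ t(1)])
    have "((\<lambda>s. x - b1 s) has_real_derivative - b1') (at t within I)"
      "((\<lambda>s. \<xi> - b2 s x) has_real_derivative - b2t) (at t within I)"
      using b1 b2 by (auto intro!: derivative_eq_intros)
    from gaussian_profile_derivative[OF c1(1) c2(1) this c1(2) c2(3)]
    show "((\<lambda>s. gaussian_ansatz b1 c1 b2 c2 s x \<xi>) has_real_derivative F * At) (at t within I)"
      unfolding F At_def gaussian_ansatz_def X \<eta>_def .
  qed (rule f)
  have fx: "((\<lambda>y. f t y \<xi>) has_real_derivative F * Ax) (at x)"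
  proof -
    have "((\<lambda>y. y - b1 t) has_real_derivative 1) (at x)" "((\<lambda>y. \<xi> - b2 t y) has_real_derivative - b2x) (at x)"
      using b2 by (auto intro!: derivative_eq_intros)
    from gaussian_profile_derivative[OF DERIV_const[of "c1 t"] c2(2) this c1(2) c2(3)]
    show ?thesis unfolding F Ax_def f[OF t(1)] gaussian_ansatz_def X \<eta>_def .
  qed
  have f\<xi>: "((\<lambda>\<eta>. f t x \<eta>) has_real_derivative F * A\<xi>) (at \<xi>)"
  proof -
    have "((\<lambda>\<eta>. \<eta> - b2 t x) has_real_derivative 1) (at \<xi>)"
      by (auto intro!: derivative_eq_intros)
    from gaussian_profile_derivative[OF DERIV_const[of "c1 t"] DERIV_const[of "c2 t x"] DERIV_const[of "x - b1 t"] this c1(2) c2(3)]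
    show ?thesis unfolding F A\<xi>_def f[OF t(1)] gaussian_ansatz_def X \<eta>_def .
  qed
  have r: "((\<lambda>y. ln (spatial_density f t y)) has_real_derivative - 2 * X / (c1 t)\<^sup>2) (at x)"
  proof -
    have "spatial_density f t y = 1 / (sqrt pi * c1 t) * exp (- ((y - b1 t)\<^sup>2 / (c1 t)\<^sup>2))" for y
      using c1 c2 f[OF t(1)] by (intro spatial_density_ansatz) auto
    hence "ln (spatial_density f t y) = ln (1 / (sqrt pi * c1 t)) - (y - b1 t)\<^sup>2 / (c1 t)\<^sup>2" for y
      using c1 by (simp add: ln_mult ln_div)
    moreover have "((\<lambda>y. ln (1 / (sqrt pi * c1 t)) - (y - b1 t)\<^sup>2 / (c1 t)\<^sup>2)
        has_real_derivative - 2 * X / (c1 t)\<^sup>2) (at x)"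
      by (rule DERIV_cong[OF DERIV_diff[OF DERIV_const DERIV_cdivide[OF DERIV_power[OF DERIV_diff[OF DERIV_ident DERIV_const], where n = 2]]]])
         (use c1(2) in \<open>simp add: X field_simps\<close>)
    ultimately show ?thesis by simp
  qed
  have "?E \<longleftrightarrow> F * At + \<xi> * (F * Ax) - lam * (- 2 * X / (c1 t)\<^sup>2) * (F * A\<xi>) = 0"
  proof
    assume ?E
    then obtain ft' fx' f\<xi>' r' where *: "((\<lambda>s. f s x \<xi>) has_real_derivative ft') (at t within I)"
        "((\<lambda>y. f t y \<xi>) has_real_derivative fx') (at x)"
        "((\<lambda>\<eta>. f t x \<eta>) has_real_derivative f\<xi>') (at \<xi>)"
        "((\<lambda>y. ln (spatial_density f t y)) has_real_derivative r') (at x)"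
        "ft' + \<xi> * fx' - lam * r' * f\<xi>' = 0" by blast
    have "ft' = F * At" using real_derivative_unique_within[OF t(2) *(1) ft] .
    moreover have "fx' = F * Ax" using DERIV_unique[OF *(2) fx] .
    moreover have "f\<xi>' = F * A\<xi>" using DERIV_unique[OF *(3) f\<xi>] .
    moreover have "r' = - 2 * X / (c1 t)\<^sup>2" using DERIV_unique[OF *(4) r] .
    ultimately show "F * At + \<xi> * (F * Ax) - lam * (- 2 * X / (c1 t)\<^sup>2) * (F * A\<xi>) = 0" using *(5) by simp
  qed (use ft fx f\<xi> r in blast)
  also have "F * At + \<xi> * (F * Ax) - lam * (- 2 * X / (c1 t)\<^sup>2) * (F * A\<xi>)
      = F * (At + \<xi> * Ax + 2 * lam * X / (c1 t)\<^sup>2 * A\<xi>)" by (simp add: algebra_simps)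
  also have "At + \<xi> * Ax + 2 * lam * X / (c1 t)\<^sup>2 * A\<xi> = ?p"
  proof -
    have \<xi>: "\<xi> = \<eta> + b2 t x" by (simp add: \<eta>_def)
    show ?thesis unfolding At_def Ax_def A\<xi>_def p0 p1 p2 p3 \<eta>_def[symmetric] unfolding \<xi>
      by (simp add: algebra_simps add_divide_distrib diff_divide_distrib power2_eq_square power3_eq_cube)
  qed
  finally show ?thesis using \<open>F > 0\<close> by simp
qed

text \<open>Four distinct nodes suffice for degree three.\<close>

lemma cubic_vanishing:
  fixes p0 p1 p2 p3 a :: real
  assumes "\<And>x. p0 + p1 * (x - a) + p2 * (x - a)\<^sup>2 + p3 * (x - a) ^ 3 = 0"
  shows "p0 = 0" "p1 = 0" "p2 = 0" "p3 = 0"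
  using assms[of a] assms[of "a + 1"] assms[of "a - 1"] assms[of "a + 2"]
  by (simp_all add: power2_eq_square power3_eq_cube)

text \<open>The four coefficients vanish for separate reasons: \<open>c2\<close> is constant in x
  (p3), its logarithmic time derivative is minus the slope of \<open>b2\<close> (p2), the equation
  for \<open>c1\<close> balances the forces (p1), and the Gaussian of the density is transported by
  \<open>b2\<close> (p0).\<close>

lemma KIE_solution_gaussian:
  assumes I: "\<And>t. t \<in> I \<Longrightarrow> at t within I \<noteq> bot"
    and C: "C > 0"
    and c1: "\<And>t. t \<in> I \<Longrightarrow> c1 t > 0"
      "\<And>t. t \<in> I \<Longrightarrow> (c1 has_real_derivative c1' t) (at t within I)"
      "\<And>t. t \<in> I \<Longrightarrow> (c1' has_real_derivative 2 * lam / c1 t + C\<^sup>2 / c1 t ^ 3) (at t within I)"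
    and f: "\<And>t x \<xi>. t \<in> I \<Longrightarrow> f t x \<xi> = gaussian_ansatz (\<lambda>t. B1 * t + B0) c1
        (\<lambda>t x. c1' t / c1 t * (x - B1 * t - B0) + B1) (\<lambda>t x. C / c1 t) t x \<xi>"
  shows "KIE_solution lam I f"
  unfolding KIE_solution_def
proof (intro conjI ballI allI)
  fix t x assume t: "t \<in> I"
  have pos: "c1 t > 0" "C / c1 t > 0" using c1 t C by auto
  note dens = spatial_density_ansatz[where f = f and t = t and x = x, OF pos f[OF t]]
  show "integrable lborel (f t x)" by (rule dens)
  show "0 < spatial_density f t x" using pos by (simp add: dens)
next
  fix t x \<xi> assume t: "t \<in> I"
  define X where "X = x - (B1 * t + B0)"
  have pos: "c1 t > 0" "C / c1 t > 0" using c1 t C by auto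
  have nz: "c1 t \<noteq> 0" using pos by simp
  define a E where "a = c1' t / c1 t" and "E = 2 * lam / c1 t + C\<^sup>2 / c1 t ^ 3"
  have c1'd: "(c1' has_real_derivative E) (at t within I)" using c1(3)[OF t] by (simp add: E_def)
  have "((\<lambda>s. x - B1 * s - B0) has_real_derivative - B1) (at t within I)"
    by (auto intro!: derivative_eq_intros)
  from DERIV_add[OF DERIV_mult[OF DERIV_divide[OF c1'd c1(2)[OF t]] this] DERIV_const[of B1]]
  have b2t: "((\<lambda>s. c1' s / c1 s * (x - B1 * s - B0) + B1) has_real_derivative
      (E / c1 t - a\<^sup>2) * X - a * B1) (at t within I)"
    by (rule DERIV_cong)
       (simp_all add: nz X_def a_def diff_divide_distrib power2_eq_square diff_diff_eq)
  have b2x: "((\<lambda>y. c1' t / c1 t * (y - B1 * t - B0) + B1) has_real_derivative a) (at x)"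
    by (auto intro!: derivative_eq_intros simp: a_def nz)
  have c2t: "((\<lambda>s. C / c1 s) has_real_derivative - C * a / c1 t) (at t within I)"
    by (rule DERIV_cong[OF DERIV_divide[OF DERIV_const c1(2)[OF t]]]) (simp_all add: nz a_def)
  have b1: "((\<lambda>t. B1 * t + B0) has_real_derivative B1) (at t within I)"
    by (auto intro!: derivative_eq_intros)
  have b2: "c1' t / c1 t * (x - B1 * t - B0) + B1 = a * X + B1" by (simp add: X_def a_def diff_diff_eq)
  have p0: "0 = - c1' t / c1 t - (- C * a / c1 t) / (C / c1 t) + 2 * X * B1 / (c1 t)\<^sup>2
      + 2 * X\<^sup>2 * c1' t / (c1 t) ^ 3 - (c1' t / c1 t * (x - B1 * t - B0) + B1) * (0 / (C / c1 t) + 2 * X / (c1 t)\<^sup>2)"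
    unfolding b2 using pos C by (simp add: a_def field_simps power2_eq_square power3_eq_cube)
  \<comment> \<open>Acceleration along \<open>b2\<close> minus the \<open>lam\<close> force. What
    remains is (c2 / c1)^2 X, which the factor 2 / c2^2 turns into the other term of p1.\<close>
  have "(E / c1 t - a\<^sup>2) * X - a * B1 + (a * X + B1) * a - 2 * lam * X / (c1 t)\<^sup>2 = (E / c1 t - 2 * lam / (c1 t)\<^sup>2) * X"
    by (simp add: algebra_simps power2_eq_square)
  also have "E / c1 t - 2 * lam / (c1 t)\<^sup>2 = (C / c1 t)\<^sup>2 / (c1 t)\<^sup>2"
    using pos by (simp add: E_def field_simps power2_eq_square power3_eq_cube)
  finally have p1: "0 = 2 * ((E / c1 t - a\<^sup>2) * X - a * B1 + (c1' t / c1 t * (x - B1 * t - B0) + B1) * a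
      - 2 * lam * X / (c1 t)\<^sup>2) / (C / c1 t)\<^sup>2 - 2 * X / (c1 t)\<^sup>2 - 0 / (C / c1 t)"
    unfolding b2 using C nz by simp
  have p2: "0 = 2 * (- C * a / c1 t + (c1' t / c1 t * (x - B1 * t - B0) + B1) * 0) / (C / c1 t) ^ 3 + 2 * a / (C / c1 t)\<^sup>2"
    using pos C by (simp add: field_simps power2_eq_square power3_eq_cube)
  have p3: "0 = 2 * 0 / (C / c1 t) ^ 3" by simp
  show "\<exists>ft fx f\<xi> r.
        ((\<lambda>s. f s x \<xi>) has_real_derivative ft) (at t within I) \<and>
        ((\<lambda>y. f t y \<xi>) has_real_derivative fx) (at x) \<and>
        ((\<lambda>\<eta>. f t x \<eta>) has_real_derivative f\<xi>) (at \<xi>) \<and>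
        ((\<lambda>y. ln (spatial_density f t y)) has_real_derivative r) (at x) \<and>
        ft + \<xi> * fx - lam * r * f\<xi> = 0"
    by (subst ansatz_kinetic_iff[OF t I[OF t] c1(2)[OF t] pos(1) b1 b2t b2x c2t DERIV_const pos(2) f X_def p0 p1 p2 p3]) simp_all
qed

section \<open>Asymptotics\<close>

lemma right_interval_not_bot:
  fixes t e :: real
  assumes "e > 0" "{t..t + e} \<subseteq> I"
  shows "at t within I \<noteq> bot"
proof -
  have "at t within {t..t + e} = at_right t" using assms(1) by (intro at_within_Icc_at_right) simp
  moreover have "at t within {t..t + e} \<le> at t within I" using assms(2) by (rule at_le)
  ultimately show ?thesis using trivial_limit_at_right_real[of t] by (metis bot.extremum_unique trivial_limit_def)
qed

lemma half_line_not_bot: "t \<in> {0::real..} \<Longrightarrow> at t within {0..} \<noteq> bot"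
  by (rule right_interval_not_bot[of 1]) auto

lemma time_interval_not_bot:
  assumes "t \<in> time_interval T"
  shows "at t within time_interval T \<noteq> bot"
proof -
  have "ereal t < T" "t \<ge> 0" using assms by (auto simp: time_interval_def)
  then obtain r where r: "t < r" "ereal r < T" using ereal_dense2[of "ereal t" T] by auto
  have "{t..t + (r - t)} \<subseteq> time_interval T"
    using r \<open>t \<ge> 0\<close> by (auto simp: time_interval_def intro: le_less_trans[of "ereal _" "ereal r"])
  thus ?thesis using r by (intro right_interval_not_bot[of "r - t"]) auto
qed

lemma convex_time_interval: "convex (time_interval T)"
proof -
  have "is_interval (time_interval T)"
    unfolding is_interval_1 time_interval_def
    by (auto intro: le_less_trans[of "ereal _" "ereal _"])
  thus ?thesis by (rule is_interval_convex)
qed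

text \<open>\<open>relation_a\<close> and \<open>is_tau\<close> only demand nonvanishing; a sign
  change would produce a zero by the intermediate value theorem.\<close>

lemma nonvanishing_pos:
  fixes u :: "real \<Rightarrow> real"
  assumes "continuous_on {0..} u" "\<And>t. t \<ge> 0 \<Longrightarrow> u t \<noteq> 0" "u 0 > 0" "t \<ge> 0"
  shows "u t > 0"
proof (rule ccontr)
  assume "\<not> u t > 0"
  moreover have "continuous_on {0..t} u" using assms(1) by (rule continuous_on_subset) auto
  ultimately obtain s where "0 \<le> s" "u s = 0" using IVT2'[of u t 0 0] assms by auto
  thus False using assms(2) by blast
qed

lemma Cinf_on_twice:
  fixes c :: "real \<Rightarrow> real"
  assumes "\<And>t. t \<in> I \<Longrightarrow> at t within I \<noteq> bot" "Cinf_on I c" "t \<in> I"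
  shows "(c has_real_derivative Dt I c t) (at t within I)"
    "(Dt I c has_real_derivative Dt I (Dt I c) t) (at t within I)"
proof -
  have "Ck_on (Suc (Suc 0)) I c" using assms(2) unfolding Cinf_on_def by blast
  note 1 = Ck_on_SucD_real[OF assms(1) this]
  note 2 = Ck_on_SucD_real[OF assms(1) 1(2)]
  show "(c has_real_derivative Dt I c t) (at t within I)" using 1(1) assms(3) by blast
  show "(Dt I c has_real_derivative Dt I (Dt I c) t) (at t within I)" using 2(1) assms(3) by blast
qed

text \<open>The first three facts include t = 0 and feed the kinetic equation; the last restricts to
  positive times and feeds the asymptotics.\<close>

lemma relation_a_scale_ode:
  assumes "lam > 0" "Cinf_on {0..} c1" "c10 > 0" "relation_a lam {0..} c10 c11 c20 c1"
  shows "\<And>t. t \<ge> 0 \<Longrightarrow> c1 t > 0"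
    "\<And>t. t \<ge> 0 \<Longrightarrow> (c1 has_real_derivative Dt {0..} c1 t) (at t within {0..})"
    "\<And>t. t \<ge> 0 \<Longrightarrow> (Dt {0..} c1 has_real_derivative 2 * lam / c1 t + (c10 * c20)\<^sup>2 / c1 t ^ 3) (at t within {0..})"
    "scale_ode lam (c10 * c20) c1 (Dt {0..} c1)"
proof -
  have a: "c1 0 = c10" "\<And>t. t \<ge> 0 \<Longrightarrow> c1 t \<noteq> 0"
    "\<And>t. t \<ge> 0 \<Longrightarrow> Dt {0..} (Dt {0..} c1) t = 2 * lam / c1 t + (c10 * c20)\<^sup>2 / c1 t ^ 3"
    using assms(4) by (auto simp: relation_a_def)
  show d1: "(c1 has_real_derivative Dt {0..} c1 t) (at t within {0..})" if "t \<ge> 0" for t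
    using Cinf_on_twice(1)[OF half_line_not_bot assms(2)] that by simp
  show d2: "(Dt {0..} c1 has_real_derivative 2 * lam / c1 t + (c10 * c20)\<^sup>2 / c1 t ^ 3) (at t within {0..})" if "t \<ge> 0" for t
    using Cinf_on_twice(2)[OF half_line_not_bot assms(2)] that a(3) by simp
  have cont: "continuous_on {0..} c1"
    using d1 by (intro DERIV_continuous_on) auto
  show pos: "c1 t > 0" if "t \<ge> 0" for t
    by (rule nonvanishing_pos[OF cont a(2) _ that]) (simp_all add: a(1) assms(3))
  have i: "at t within {0..} = at t" if "t > 0" for t :: real
    using that by (intro at_within_interior) (simp add: interior_real_atLeast)
  show "scale_ode lam (c10 * c20) c1 (Dt {0..} c1)"
  proof
    fix t :: real assume t: "t > 0"
    show "c1 t > 0" using pos t by simp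
    show "(c1 has_real_derivative Dt {0..} c1 t) (at t)" using d1[of t] t i by simp
    show "(Dt {0..} c1 has_real_derivative 2 * lam / c1 t + (c10 * c20)\<^sup>2 / c1 t ^ 3) (at t)"
      using d2[of t] t i by simp
  qed fact
qed

lemma is_tau_scale_ode:
  assumes "lam > 0" "is_tau lam \<tau>"
  shows "\<And>t. t \<ge> 0 \<Longrightarrow> \<tau> t > 0" "scale_ode lam 0 \<tau> (Dt UNIV \<tau>)"
proof -
  have nb: "at t within UNIV \<noteq> bot" for t :: real by simp
  have a: "\<tau> 0 = 1" "Cinf_on UNIV \<tau>" "\<And>t. \<tau> t \<noteq> 0" "\<And>t. Dt UNIV (Dt UNIV \<tau>) t = 2 * lam / \<tau> t"
    using assms(2) by (auto simp: is_tau_def)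
  note d = Cinf_on_twice[OF nb a(2) UNIV_I]
  have "continuous_on UNIV \<tau>" using d(1) by (intro DERIV_continuous_on) auto
  hence cont: "continuous_on {0..} \<tau>" by (rule continuous_on_subset) auto
  show pos: "\<tau> t > 0" if "t \<ge> 0" for t
    by (rule nonvanishing_pos[OF cont a(3) _ that]) (simp add: a(1))
  show "scale_ode lam 0 \<tau> (Dt UNIV \<tau>)"
    using assms(1) pos d a(4) by unfold_locales auto
qed

text \<open>For tau > 0 the change of variables is invertible, so \<open>ftilde\<close> is
  determined and is Gaussian in the velocity, with centre \<open>m\<close> and width
  \<open>tau * c2 t\<close>. The shear by \<open>tau'\<close> only moves \<open>m\<close> and
  disappears on integration.\<close>

lemma rescaled_density:
  assumes pos: "tau > 0" "c1 t > 0" "c2 t > 0"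
    and f: "\<And>x \<xi>. f t x \<xi> = gaussian_ansatz b1 c1 b2 (\<lambda>t x. c2 t) t x \<xi>"
    and ft: "\<And>x \<xi>. f t x \<xi> = 1 / sqrt pi * ftilde t (x / tau) (tau * \<xi> - tau' * x)"
  shows "integrable lborel (ftilde t y)"
    "spatial_density ftilde t y = 1 / (c1 t / tau) * exp (- ((y - b1 t / tau)\<^sup>2 / (c1 t / tau)\<^sup>2))"
proof -
  define m where "m = tau * b2 t (tau * y) - tau' * (tau * y)"
  define k where "k = sqrt pi * (1 / (pi * c1 t * c2 t) * exp (- ((tau * y - b1 t)\<^sup>2 / (c1 t)\<^sup>2)))"
  have "ftilde t y \<eta> = k * exp (- ((\<eta> - m)\<^sup>2 / (tau * c2 t)\<^sup>2))" for \<eta>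
  proof -
    have "ftilde t y \<eta> = sqrt pi * f t (tau * y) ((\<eta> + tau' * (tau * y)) / tau)"
      using pos by (simp add: ft)
    moreover have "(\<eta> + tau' * (tau * y)) / tau - b2 t (tau * y) = (\<eta> - m) / tau"
      using pos by (simp add: m_def field_simps)
    ultimately show ?thesis
      by (simp add: f gaussian_ansatz_def k_def power_divide power_mult_distrib exp_diff exp_minus field_simps)
  qed
  hence eq: "ftilde t y = (\<lambda>\<eta>. k * exp (- ((\<eta> - m)\<^sup>2 / (tau * c2 t)\<^sup>2)))" by (rule ext)
  have "has_bochner_integral lborel (\<lambda>\<eta>. k * exp (- ((\<eta> - m)\<^sup>2 / (tau * c2 t)\<^sup>2))) (k * (sqrt pi * (tau * c2 t)))"
    using pos by (intro has_bochner_integral_mult_right has_bochner_integral_exp_square) auto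
  hence *: "has_bochner_integral lborel (ftilde t y) (k * (sqrt pi * (tau * c2 t)))"
    by (simp only: eq)
  have "sqrt pi * sqrt pi = pi" by simp
  hence "k * (sqrt pi * (tau * c2 t)) = tau / c1 t * exp (- ((tau * y - b1 t)\<^sup>2 / (c1 t)\<^sup>2))"
    unfolding k_def using pos by (simp add: field_simps)
  also have "(tau * y - b1 t) / c1 t = (y - b1 t / tau) / (c1 t / tau)"
    using pos by (simp add: field_simps)
  hence "(tau * y - b1 t)\<^sup>2 / (c1 t)\<^sup>2 = (y - b1 t / tau)\<^sup>2 / (c1 t / tau)\<^sup>2"
    by (simp only: power_divide[symmetric])
  finally show "spatial_density ftilde t y = 1 / (c1 t / tau) * exp (- ((y - b1 t / tau)\<^sup>2 / (c1 t / tau)\<^sup>2))"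
    using * by (simp add: spatial_density_def has_bochner_integral_integral_eq)
  show "integrable lborel (ftilde t y)" using * by (simp add: has_bochner_integral_iff)
qed

text \<open>\<open>scale_ode_ratio\<close> controls the width and \<open>u_lower_asymp\<close>,
  applied to \<open>v\<close>, the centre; for large times both enter the range where
  \<open>L1_norm_gaussian_diff\<close> holds.\<close>

lemma L1_norm_rescaled_bigo:
  assumes u: "scale_ode lam C u u'" and v: "scale_ode lam D v v'"
  shows "(\<lambda>t. L1_norm (\<lambda>y. 1 / (u t / v t) * exp (- ((y - (B1 * t + B0) / v t)\<^sup>2 / (u t / v t)\<^sup>2)) - (gauss y)\<^sup>2))
    \<in> O(\<lambda>t. sqrt (ln (ln t) / ln t))"
proof -
  interpret v: scale_ode lam D v v' by fact
  define s where "s = (\<lambda>t. u t / v t)"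
  define m where "m = (\<lambda>t. (B1 * t + B0) / v t)"
  obtain c where c: "c > 0" "\<forall>\<^sub>F t in at_top. norm (s t - 1) \<le> c * norm (1 / ln t)"
    using scale_ode_ratio[OF u v] unfolding s_def by (rule landau_o.bigE)
  obtain a where a: "a > 0" "\<forall>\<^sub>F t in at_top. v t \<ge> a * t * sqrt (ln t)"
    using v.u_lower_asymp by blast
  define d where "d = (\<bar>B1\<bar> + \<bar>B0\<bar>) / a"
  have m: "\<forall>\<^sub>F t in at_top. \<bar>m t\<bar> \<le> d / sqrt (ln t)"
    using a(2) eventually_gt_at_top[of 1]
  proof eventually_elim
    case (elim t)
    have pos: "a * t * sqrt (ln t) > 0" using a(1) elim by simp
    have "\<bar>B1 * t + B0\<bar> \<le> \<bar>B1\<bar> * t + \<bar>B0\<bar> * 1"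
      using elim by (simp add: abs_mult order_trans[OF abs_triangle_ineq])
    also have "\<dots> \<le> \<bar>B1\<bar> * t + \<bar>B0\<bar> * t" using elim by (intro add_left_mono mult_left_mono) auto
    finally have "\<bar>B1 * t + B0\<bar> / v t \<le> (\<bar>B1\<bar> * t + \<bar>B0\<bar> * t) / (a * t * sqrt (ln t))"
      using elim pos by (intro frac_le) auto
    also have "\<dots> = d / sqrt (ln t)" using elim a(1) by (simp add: d_def field_simps)
    also have "\<bar>B1 * t + B0\<bar> / v t = \<bar>m t\<bar>" using elim pos by (simp add: m_def abs_divide)
    finally show ?case .
  qed
  obtain K where K: "K \<ge> 0" "\<And>s m. \<bar>s - 1\<bar> \<le> 1/2 \<Longrightarrow> \<bar>m\<bar> \<le> 1 \<Longrightarrow>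
     L1_norm (\<lambda>y. 1 / s * exp (- ((y - m)\<^sup>2 / s\<^sup>2)) - (gauss y)\<^sup>2) \<le> K * (\<bar>s - 1\<bar> + \<bar>m\<bar>)"
    using L1_norm_gaussian_diff by blast
  have "\<forall>\<^sub>F t::real in at_top. c / ln t \<le> 1/2" by real_asymp
  moreover have "\<forall>\<^sub>F t::real in at_top. d / sqrt (ln t) \<le> 1" by real_asymp
  ultimately have "\<forall>\<^sub>F t in at_top. norm (L1_norm (\<lambda>y. 1 / s t * exp (- ((y - m t)\<^sup>2 / (s t)\<^sup>2)) - (gauss y)\<^sup>2))
      \<le> K * norm (c / ln t + d / sqrt (ln t))"
    using c(2) m eventually_gt_at_top[of 1]
  proof eventually_elim
    case (elim t)
    have s: "\<bar>s t - 1\<bar> \<le> c / ln t" using elim by simp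
    have "L1_norm (\<lambda>y. 1 / s t * exp (- ((y - m t)\<^sup>2 / (s t)\<^sup>2)) - (gauss y)\<^sup>2) \<le> K * (\<bar>s t - 1\<bar> + \<bar>m t\<bar>)"
      using s elim by (intro K(2)) linarith+
    also have "\<dots> \<le> K * (c / ln t + d / sqrt (ln t))" using s elim K(1) by (intro mult_left_mono add_mono) auto
    also have "\<dots> \<le> K * norm (c / ln t + d / sqrt (ln t))" using K(1) by (intro mult_left_mono) auto
    finally show ?case by (simp add: L1_norm_def)
  qed
  hence "(\<lambda>t. L1_norm (\<lambda>y. 1 / s t * exp (- ((y - m t)\<^sup>2 / (s t)\<^sup>2)) - (gauss y)\<^sup>2)) \<in> O(\<lambda>t. c / ln t + d / sqrt (ln t))"
    by (rule bigoI)
  \<comment> \<open>Each term is within the bound because ln (ln t) is eventually at least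
    1.\<close>
  also have "(\<lambda>t. c / ln t + d / sqrt (ln t)) \<in> O(\<lambda>t. sqrt (ln (ln t) / ln t))"
  proof (rule sum_in_bigo)
    show "(\<lambda>t. c / ln t) \<in> O(\<lambda>t::real. sqrt (ln (ln t) / ln t))"
      by (rule landau_o.big_trans[of _ _ "\<lambda>t. 1 / ln t"]) (simp add: divide_inverse, real_asymp)
    show "(\<lambda>t. d / sqrt (ln t)) \<in> O(\<lambda>t::real. sqrt (ln (ln t) / ln t))"
      by (rule landau_o.big_trans[of _ _ "\<lambda>t. 1 / sqrt (ln t)"]) (simp add: divide_inverse, real_asymp)
  qed
  finally show ?thesis by (simp add: s_def m_def)
qed

text \<open>The two integrability claims certify that \<open>spatial_density\<close> and
  \<open>L1_norm\<close> are genuine integrals here, since the Bochner integral of a nonintegrable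
  function is 0.\<close>

lemma gaussian_solution_asymptotics:
  assumes "lam > 0" "c10 > 0" "c20 > 0" "Cinf_on {0..} c1"
    and a: "relation_a lam {0..} c10 c11 c20 c1" and b: "relation_b {0..} c10 c20 B0 B1 b1 c1 b2 c2"
    and f: "\<And>t x \<xi>. t \<ge> 0 \<Longrightarrow> f t x \<xi> = gaussian_ansatz b1 c1 b2 (\<lambda>t x. c2 t) t x \<xi>"
    and tau: "is_tau lam \<tau>"
    and ft: "\<And>t x \<xi>. t \<ge> 0 \<Longrightarrow> f t x \<xi> =
       1 / L1_norm (\<lambda>y. (gauss y)\<^sup>2) * ftilde t (x / \<tau> t) (\<tau> t * \<xi> - Dt UNIV \<tau> t * x)"
  shows "\<And>t y. t \<ge> 0 \<Longrightarrow> integrable lborel (ftilde t y)"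
    "\<And>t. t \<ge> 0 \<Longrightarrow> integrable lborel (\<lambda>y. spatial_density ftilde t y - (gauss y)\<^sup>2)"
    "(\<lambda>t. L1_norm (\<lambda>y. spatial_density ftilde t y - (gauss y)\<^sup>2)) \<in> O[at_top](\<lambda>t. sqrt (ln (ln t) / ln t))"
proof -
  note c1 = relation_a_scale_ode[OF assms(1) assms(4) assms(2) a]
  note \<tau> = is_tau_scale_ode[OF assms(1) tau]
  have b1: "b1 t = B1 * t + B0" "c2 t > 0" if "t \<ge> 0" for t
    using b that c1(1) assms(2,3) by (auto simp: relation_b_def)
  note ft' = ft[unfolded L1_norm_gauss_square]
  note dens = rescaled_density[where f = f and ftilde = ftilde, OF \<tau>(1) c1(1) b1(2) f ft']
  show "integrable lborel (ftilde t y)" if "t \<ge> 0" for t y using dens(1) that by blast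
  have d: "spatial_density ftilde t y = 1 / (c1 t / \<tau> t) * exp (- ((y - b1 t / \<tau> t)\<^sup>2 / (c1 t / \<tau> t)\<^sup>2))"
    if "t \<ge> 0" for t y using dens(2) that by blast
  show "integrable lborel (\<lambda>y. spatial_density ftilde t y - (gauss y)\<^sup>2)" if "t \<ge> 0" for t
  proof -
    have "c1 t / \<tau> t > 0" using c1(1) \<tau>(1) that by simp
    thus ?thesis
      unfolding d[OF that]
      using has_bochner_integral_exp_square[of "c1 t / \<tau> t" "b1 t / \<tau> t"] has_bochner_integral_gauss_square
      by (intro Bochner_Integration.integrable_diff integrable_mult_right)
         (auto simp: has_bochner_integral_iff)
  qed
  show "(\<lambda>t. L1_norm (\<lambda>y. spatial_density ftilde t y - (gauss y)\<^sup>2)) \<in> O[at_top](\<lambda>t. sqrt (ln (ln t) / ln t))"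
  proof (rule iffD2[OF landau_o.big.in_cong])
    show "\<forall>\<^sub>F t in at_top. L1_norm (\<lambda>y. spatial_density ftilde t y - (gauss y)\<^sup>2)
      = L1_norm (\<lambda>y. 1 / (c1 t / \<tau> t) * exp (- ((y - (B1 * t + B0) / \<tau> t)\<^sup>2 / (c1 t / \<tau> t)\<^sup>2)) - (gauss y)\<^sup>2)"
      using eventually_ge_at_top[of 0] by eventually_elim (simp only: d b1)
  qed (rule L1_norm_rescaled_bigo[OF c1(4) \<tau>(2)])
qed

section \<open>Rigidity\<close>

text \<open>The bootstrap carries \<open>c\<close> and \<open>c'\<close> together: one step
  differentiates \<open>c\<close> to \<open>c'\<close>, and \<open>c'\<close> to a polynomial in 1 /
  c.\<close>

lemma scale_ode_Ck_on:
  fixes c c' :: "real \<Rightarrow> real"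
  assumes "\<And>t. t \<in> I \<Longrightarrow> c t \<noteq> 0"
    "\<And>t. t \<in> I \<Longrightarrow> (c has_real_derivative c' t) (at t within I)"
    "\<And>t. t \<in> I \<Longrightarrow> (c' has_real_derivative 2 * lam / c t + C\<^sup>2 / c t ^ 3) (at t within I)"
  shows "Ck_on k I c \<and> Ck_on k I c'"
proof (induction k)
  case 0
  show ?case using DERIV_continuous_on[of I c c'] assms
      DERIV_continuous_on[of I c' "\<lambda>t. 2 * lam / c t + C\<^sup>2 / c t ^ 3"] by simp
next
  case (Suc k)
  have i: "Ck_on k I (\<lambda>t. inverse (c t))" using Suc assms(1) Ck_on_inverse by blast
  have "Ck_on k I (\<lambda>t. (2 * lam) * inverse (c t) + C\<^sup>2 * (inverse (c t) * (inverse (c t) * inverse (c t))))"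
    by (intro Ck_on_add Ck_on_mult Ck_on_const i)
  also have "(\<lambda>t. (2 * lam) * inverse (c t) + C\<^sup>2 * (inverse (c t) * (inverse (c t) * inverse (c t))))
      = (\<lambda>t. 2 * lam / c t + C\<^sup>2 / c t ^ 3)"
    by (simp add: field_simps power3_eq_cube)
  finally have "Ck_on k I (\<lambda>t. 2 * lam / c t + C\<^sup>2 / c t ^ 3)" .
  thus ?case
    using Ck_on_SucI_real[OF assms(2)] Ck_on_SucI_real[OF assms(3)] Suc by simp
qed

text \<open>Since \<open>b2\<close> turns out to be affine in \<open>x\<close> with slope \<open>c1' / c1\<close>, the derivatives \<open>c1'\<close> and \<open>b1'\<close>
  inherit differentiability in time from \<open>b2\<close>.\<close>

lemma gaussian_solution_structure:
  fixes b2 c2 b2t b2x c2t c2x :: "real \<Rightarrow> real \<Rightarrow> real"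
  assumes I: "\<And>t. t \<in> I \<Longrightarrow> at t within I \<noteq> bot" "convex I" "0 \<in> I"
    and c1: "\<And>t. t \<in> I \<Longrightarrow> (c1 has_real_derivative c1' t) (at t within I)" "\<And>t. t \<in> I \<Longrightarrow> c1 t > 0"
    and b1: "\<And>t. t \<in> I \<Longrightarrow> (b1 has_real_derivative b1' t) (at t within I)"
    and b2: "\<And>t x. t \<in> I \<Longrightarrow> ((\<lambda>s. b2 s x) has_real_derivative b2t t x) (at t within I)"
      "\<And>t x. t \<in> I \<Longrightarrow> ((\<lambda>y. b2 t y) has_real_derivative b2x t x) (at x)"
    and c2: "\<And>t x. t \<in> I \<Longrightarrow> ((\<lambda>s. c2 s x) has_real_derivative c2t t x) (at t within I)"
      "\<And>t x. t \<in> I \<Longrightarrow> ((\<lambda>y. c2 t y) has_real_derivative c2x t x) (at x)" "\<And>t x. t \<in> I \<Longrightarrow> c2 t x > 0"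
    and f: "\<And>t x \<xi>. t \<in> I \<Longrightarrow> f t x \<xi> = gaussian_ansatz b1 c1 b2 c2 t x \<xi>"
    and KIE: "KIE_solution lam I f"
  shows "\<exists>B0 B1. \<forall>t\<in>I. (\<forall>x. c2 t x = c1 0 * c2 0 0 / c1 t) \<and> b1 t = B1 * t + B0 \<and>
    (\<forall>x. b2 t x = c1' t / c1 t * (x - B1 * t - B0) + B1) \<and>
    (c1' has_real_derivative 2 * lam / c1 t + (c1 0 * c2 0 0)\<^sup>2 / c1 t ^ 3) (at t within I)"
proof -
  have poly: "- c1' t / c1 t - c2t t x / c2 t x + 2 * (x - b1 t) * b1' t / (c1 t)\<^sup>2 + 2 * (x - b1 t)\<^sup>2 * c1' t / (c1 t) ^ 3
        - b2 t x * (c2x t x / c2 t x + 2 * (x - b1 t) / (c1 t)\<^sup>2) = 0"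
    "2 * (b2t t x + b2 t x * b2x t x - 2 * lam * (x - b1 t) / (c1 t)\<^sup>2) / (c2 t x)\<^sup>2 - 2 * (x - b1 t) / (c1 t)\<^sup>2 - c2x t x / c2 t x = 0"
    "2 * (c2t t x + b2 t x * c2x t x) / (c2 t x) ^ 3 + 2 * b2x t x / (c2 t x)\<^sup>2 = 0"
    "2 * c2x t x / (c2 t x) ^ 3 = 0" if t: "t \<in> I" for t x
  proof -
    define p0 p1 p2 p3 where "p0 = - c1' t / c1 t - c2t t x / c2 t x + 2 * (x - b1 t) * b1' t / (c1 t)\<^sup>2
        + 2 * (x - b1 t)\<^sup>2 * c1' t / (c1 t) ^ 3 - b2 t x * (c2x t x / c2 t x + 2 * (x - b1 t) / (c1 t)\<^sup>2)"
      and "p1 = 2 * (b2t t x + b2 t x * b2x t x - 2 * lam * (x - b1 t) / (c1 t)\<^sup>2) / (c2 t x)\<^sup>2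
        - 2 * (x - b1 t) / (c1 t)\<^sup>2 - c2x t x / c2 t x"
      and "p2 = 2 * (c2t t x + b2 t x * c2x t x) / (c2 t x) ^ 3 + 2 * b2x t x / (c2 t x)\<^sup>2"
      and "p3 = 2 * c2x t x / (c2 t x) ^ 3"
    note p = this
    note ex = KIE[unfolded KIE_solution_def, THEN conjunct2, rule_format, OF t]
    have "p0 + p1 * (\<xi> - b2 t x) + p2 * (\<xi> - b2 t x)\<^sup>2 + p3 * (\<xi> - b2 t x) ^ 3 = 0" for \<xi>
      by (rule iffD1[OF ansatz_kinetic_iff[OF t I(1)[OF t] c1(1)[OF t] c1(2)[OF t] b1[OF t] b2(1)[OF t]
            b2(2)[OF t] c2(1)[OF t] c2(2)[OF t] c2(3)[OF t] f refl p] ex])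
    from cubic_vanishing[OF this, unfolded p] show
    "- c1' t / c1 t - c2t t x / c2 t x + 2 * (x - b1 t) * b1' t / (c1 t)\<^sup>2 + 2 * (x - b1 t)\<^sup>2 * c1' t / (c1 t) ^ 3
        - b2 t x * (c2x t x / c2 t x + 2 * (x - b1 t) / (c1 t)\<^sup>2) = 0"
    "2 * (b2t t x + b2 t x * b2x t x - 2 * lam * (x - b1 t) / (c1 t)\<^sup>2) / (c2 t x)\<^sup>2 - 2 * (x - b1 t) / (c1 t)\<^sup>2 - c2x t x / c2 t x = 0"
    "2 * (c2t t x + b2 t x * c2x t x) / (c2 t x) ^ 3 + 2 * b2x t x / (c2 t x)\<^sup>2 = 0"
    "2 * c2x t x / (c2 t x) ^ 3 = 0" by blast+
  qed
  have c2x: "c2x t x = 0" if "t \<in> I" for t x using poly(4)[OF that, of x] c2(3)[OF that, of x] by simp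
  define k where "k = (\<lambda>t. c2 t 0)"
  define k' where "k' = (\<lambda>t. c2t t 0)"
  have k: "c2 t x = k t" if "t \<in> I" for t x
    unfolding k_def using c2(2)[OF that] c2x[OF that] DERIV_isconst_all[of "c2 t"] by metis
  have kpos: "k t > 0" if "t \<in> I" for t using c2(3)[OF that] by (simp add: k_def)
  have kd: "(k has_real_derivative k' t) (at t within I)" if "t \<in> I" for t
    unfolding k_def k'_def using c2(1)[OF that] .
  have c2t: "c2t t x = k' t" if "t \<in> I" for t x
    using real_derivative_transform[OF c2(1)[OF that, of x] that, of k] k kd[OF that]
      real_derivative_unique_within[OF I(1)[OF that]] by metis
  have b2x: "b2x t x = - k' t / k t" if "t \<in> I" for t x
    using poly(3)[OF that, of x] kpos[OF that]
    by (simp add: c2x c2t k that field_simps power2_eq_square power3_eq_cube)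
  \<comment> \<open>At the centre x = b1 t all terms of the constant coefficient with a factor x -
    b1 t vanish. The result says that c1 k has zero derivative.\<close>
  have k'k: "k' t / k t = - c1' t / c1 t" if "t \<in> I" for t
    using poly(1)[OF that, of "b1 t"] by (simp add: c2x c2t k that)
  define a where "a = (\<lambda>t. c1' t / c1 t)"
  have b2x_a: "b2x t x = a t" if "t \<in> I" for t x
    using b2x[OF that] k'k[OF that] by (simp add: a_def)
  have c1k: "c1 t * k t = c1 0 * c2 0 0" if "t \<in> I" for t
  proof -
    have "((\<lambda>t. c1 t * k t) has_real_derivative 0) (at t within I)" if t: "t \<in> I" for t
    proof (rule DERIV_cong[OF DERIV_mult[OF c1(1)[OF t] kd[OF t]]])
      show "c1' t * k t + k' t * c1 t = 0"
        using k'k[OF t] kpos[OF t] c1(2)[OF t] by (simp add: field_simps)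
    qed
    then obtain c where "\<forall>t\<in>I. c1 t * k t = c"
      using has_field_derivative_zero_constant[OF I(2), of "\<lambda>t. c1 t * k t"] by blast
    thus ?thesis using that I(3) by (simp add: k_def)
  qed
  have b2_affine: "b2 t x = b1' t + a t * (x - b1 t)" if t: "t \<in> I" for t x
  proof -
    have "((\<lambda>y. b2 t y - a t * y) has_real_derivative 0) (at y)" for y
      using b2(2)[OF t, of y] b2x_a[OF t, of y] by (auto intro!: derivative_eq_intros)
    hence "b2 t x - a t * x = b2 t (b1 t + 1) - a t * (b1 t + 1)"
      using DERIV_isconst_all by blast
    \<comment> \<open>The constant coefficient contains \<open>b2\<close> only multiplied by x - b1
      t, so the centre carries no information; distance 1 fixes the intercept.\<close>
    moreover have "b2 t (b1 t + 1) = b1' t + a t"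
    proof -
      have "2 * b1' t / (c1 t)\<^sup>2 + 2 * c1' t / (c1 t) ^ 3 - b2 t (b1 t + 1) * (2 / (c1 t)\<^sup>2) = 0"
        using poly(1)[OF t, of "b1 t + 1"] k'k[OF t] by (simp add: c2x c2t k t)
      moreover have "2 * b1' t / (c1 t)\<^sup>2 + 2 * c1' t / (c1 t) ^ 3 - b2 t (b1 t + 1) * (2 / (c1 t)\<^sup>2)
          = 2 / (c1 t)\<^sup>2 * (b1' t + a t - b2 t (b1 t + 1))"
        using c1(2)[OF t] by (simp add: a_def field_simps power2_eq_square power3_eq_cube)
      ultimately show ?thesis using c1(2)[OF t] by simp
    qed
    ultimately show ?thesis by (simp add: algebra_simps)
  qed
  \<comment> \<open>The slope \<open>a\<close> equals b2 t 1 - b2 t 0, a difference of functions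
    known to be differentiable in time.\<close>
  define a' where "a' = (\<lambda>t. b2t t 1 - b2t t 0)"
  have ad: "(a has_real_derivative a' t) (at t within I)" if t: "t \<in> I" for t
    using DERIV_diff[OF b2(1)[OF t, of 1] b2(1)[OF t, of 0]] unfolding a'_def
    by (rule real_derivative_transform[OF _ t]) (simp add: b2_affine algebra_simps)
  define b1'' where "b1'' = (\<lambda>t. b2t t 0 + (a' t * b1 t + b1' t * a t))"
  have b1'd: "(b1' has_real_derivative b1'' t) (at t within I)" if t: "t \<in> I" for t
    using DERIV_add[OF b2(1)[OF t, of 0] DERIV_mult[OF ad[OF t] b1[OF t]]] unfolding b1''_def
    by (rule real_derivative_transform[OF _ t]) (simp add: b2_affine algebra_simps)
  have b2t: "b2t t x = b1'' t + (a' t * (x - b1 t) - b1' t * a t)" if t: "t \<in> I" for t x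
  proof (rule real_derivative_unique_within[OF I(1)[OF t]])
    have "((\<lambda>s. b1' s + a s * (x - b1 s)) has_real_derivative b1'' t + (a' t * (x - b1 t) - b1' t * a t)) (at t within I)"
      using b1'd[OF t] ad[OF t] b1[OF t] by (auto intro!: derivative_eq_intros)
    thus "((\<lambda>s. b2 s x) has_real_derivative b1'' t + (a' t * (x - b1 t) - b1' t * a t)) (at t within I)"
      by (rule real_derivative_transform[OF _ t]) (simp add: b2_affine)
  qed (rule b2(1)[OF t])
  \<comment> \<open>The linear coefficient at x = b1 t + X. X = 0 gives uniform motion of the
    centre, X = 1 then gives the equation for \<open>c1\<close>.\<close>
  have momentum: "b1'' t + (a' t + (a t)\<^sup>2) * X = X * ((k t)\<^sup>2 + 2 * lam) / (c1 t)\<^sup>2" if t: "t \<in> I" for t X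
  proof -
    define A Y Z where "A = b1'' t + (a' t * X - b1' t * a t) + (b1' t + a t * X) * a t"
      and "Y = 2 * lam * X / (c1 t)\<^sup>2" and "Z = X / (c1 t)\<^sup>2"
    have "2 * (A - Y) / (k t)\<^sup>2 - 2 * Z = 0"
      using poly(2)[OF t, of "X + b1 t"]
      by (simp add: c2x k t b2t b2_affine b2x_a A_def Y_def Z_def)
    hence "A = Z * (k t)\<^sup>2 + Y" using kpos[OF t] by (simp add: field_simps)
    thus ?thesis
      by (simp add: A_def Y_def Z_def algebra_simps power2_eq_square add_divide_distrib)
  qed
  have b1''0: "b1'' t = 0" if t: "t \<in> I" for t using momentum[OF t, of 0] by simp
  obtain B1 where B1: "\<And>t. t \<in> I \<Longrightarrow> b1' t = B1"
    using has_field_derivative_zero_constant[OF I(2), of b1'] b1'd b1''0 by metis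
  have "((\<lambda>t. b1 t - B1 * t) has_real_derivative 0) (at t within I)" if t: "t \<in> I" for t
    using b1[OF t] B1[OF t] by (auto intro!: derivative_eq_intros)
  then obtain B0 where "\<forall>t\<in>I. b1 t - B1 * t = B0"
    using has_field_derivative_zero_constant[OF I(2), of "\<lambda>t. b1 t - B1 * t"] by blast
  hence B0: "b1 t = B1 * t + B0" if "t \<in> I" for t using that by (simp add: algebra_simps)
  have kC: "k t = c1 0 * c2 0 0 / c1 t" if "t \<in> I" for t
    using c1k[OF that] c1(2)[OF that] by (simp add: field_simps)
  show ?thesis
  proof (intro exI ballI conjI allI)
    fix t assume t: "t \<in> I"
    show "c2 t x = c1 0 * c2 0 0 / c1 t" for x using k kC t by simp
    show "b1 t = B1 * t + B0" using B0 t .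
    show "b2 t x = c1' t / c1 t * (x - B1 * t - B0) + B1" for x
      using b2_affine[OF t, of x] B0[OF t] B1[OF t] by (simp add: a_def algebra_simps)
    have "(c1' has_real_derivative a' t * c1 t + c1' t * a t) (at t within I)"
      using DERIV_mult[OF ad[OF t] c1(1)[OF t]]
    proof (rule real_derivative_transform[OF _ t])
      fix s assume "s \<in> I"
      thus "c1' s = a s * c1 s" using c1(2)[of s] by (simp add: a_def)
    qed
    also have "a' t * c1 t + c1' t * a t = (a' t + (a t)\<^sup>2) * c1 t"
      using c1(2)[OF t] by (simp add: a_def field_simps power2_eq_square)
    also have "\<dots> = ((k t)\<^sup>2 + 2 * lam) / (c1 t)\<^sup>2 * c1 t"
      using momentum[OF t, of 1] b1''0[OF t] by simp
    also have "\<dots> = 2 * lam / c1 t + (c1 0 * c2 0 0)\<^sup>2 / c1 t ^ 3"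
      using c1(2)[OF t] by (simp add: kC[OF t] field_simps power2_eq_square power3_eq_cube)
    finally show "(c1' has_real_derivative 2 * lam / c1 t + (c1 0 * c2 0 0)\<^sup>2 / c1 t ^ 3) (at t within I)" .
  qed
qed

text \<open>Once the structure is known, \<open>b1\<close>, \<open>b2\<close>, \<open>c2\<close> are
  on their domains polynomials in t, x, \<open>c1'\<close> and 1 / c1, so their smoothness reduces
  to that of \<open>c1\<close>.\<close>

lemma gaussian_solution_rigidity:
  fixes T :: ereal
  assumes "T > 0" and b1: "Ck_on 1 (time_interval T) b1"
    and c1: "Ck_on 1 (time_interval T) c1" "\<And>t. t \<in> time_interval T \<Longrightarrow> c1 t > 0"
    and b2: "Ck_on 1 (time_interval T \<times> UNIV) (\<lambda>(t, x). b2 t x)"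
    and c2: "Ck_on 1 (time_interval T \<times> UNIV) (\<lambda>(t, x). c2 t x)" "\<And>t x. t \<in> time_interval T \<Longrightarrow> c2 t x > 0"
    and f: "\<And>t x \<xi>. t \<in> time_interval T \<Longrightarrow> f t x \<xi> = gaussian_ansatz b1 c1 b2 c2 t x \<xi>"
    and KIE: "KIE_solution lam (time_interval T) f"
  shows "Cinf_on (time_interval T) b1" "Cinf_on (time_interval T) c1"
    "Cinf_on (time_interval T \<times> UNIV) (\<lambda>(t, x). b2 t x)"
    "Cinf_on (time_interval T \<times> UNIV) (\<lambda>(t, x). c2 t x)"
    "\<exists>c2' B0 B1.
       (\<forall>t\<in>time_interval T. \<forall>x. c2 t x = c2' t) \<and>
       relation_a lam (time_interval T) (c1 0) (Dt (time_interval T) c1 0) (c2' 0) c1 \<and>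
       relation_b (time_interval T) (c1 0) (c2' 0) B0 B1 b1 c1 b2 c2'"
proof -
  define I where "I = time_interval T"
  define c1' where "c1' = Dt I c1"
  have I: "at t within I \<noteq> bot" if "t \<in> I" for t using that time_interval_not_bot I_def by blast
  have "convex I" unfolding I_def by (rule convex_time_interval)
  have "0 \<in> I" using \<open>T > 0\<close> by (auto simp: I_def time_interval_def zero_ereal_def)
  have c1d: "(c1 has_real_derivative c1' t) (at t within I)" if "t \<in> I" for t
    unfolding c1'_def using Ck_on_SucD_real(1)[OF I, where k = 0] c1(1) that by (simp del: Ck_on.simps add: I_def)
  have b1d: "(b1 has_real_derivative Dt I b1 t) (at t within I)" if "t \<in> I" for t
    using Ck_on_SucD_real(1)[OF I, where k = 0] b1 that by (simp del: Ck_on.simps add: I_def)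
  obtain Db where Db: "\<And>t x. t \<in> I \<Longrightarrow> ((\<lambda>(t, x). b2 t x) has_derivative Db (t, x)) (at (t, x) within I \<times> UNIV)"
    using b2 by (auto simp: I_def)
  obtain Dc where Dc: "\<And>t x. t \<in> I \<Longrightarrow> ((\<lambda>(t, x). c2 t x) has_derivative Dc (t, x)) (at (t, x) within I \<times> UNIV)"
    using c2(1) by (auto simp: I_def)
  obtain B0 B1 where B: "\<And>t x. t \<in> I \<Longrightarrow> c2 t x = c1 0 * c2 0 0 / c1 t"
    "\<And>t. t \<in> I \<Longrightarrow> b1 t = B1 * t + B0"
    "\<And>t x. t \<in> I \<Longrightarrow> b2 t x = c1' t / c1 t * (x - B1 * t - B0) + B1"
    "\<And>t. t \<in> I \<Longrightarrow> (c1' has_real_derivative 2 * lam / c1 t + (c1 0 * c2 0 0)\<^sup>2 / c1 t ^ 3) (at t within I)"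
    using gaussian_solution_structure[OF I \<open>convex I\<close> \<open>0 \<in> I\<close> c1d c1(2)[folded I_def] b1d
        partial_derivatives[OF Db] partial_derivatives[OF Dc] c2(2)[folded I_def] f[folded I_def] KIE[folded I_def]]
    by blast
  have c1nz: "c1 t \<noteq> 0" if "t \<in> I" for t using c1(2)[of t] that by (simp add: I_def)
  note Ck = scale_ode_Ck_on[OF c1nz c1d B(4)]
  have id: "Ck_on k I (\<lambda>t. t)" for k by (rule Ck_on_bounded_linear[OF bounded_linear_ident])
  have fst: "Ck_on k (I \<times> (UNIV :: real set)) fst" and snd: "Ck_on k (I \<times> (UNIV :: real set)) snd" for k
    by (auto intro: Ck_on_bounded_linear bounded_linear_fst bounded_linear_snd)
  have inv: "Ck_on k (I \<times> (UNIV :: real set)) (\<lambda>p. inverse (c1 (fst p)))" for k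
    using Ck[of k] c1nz by (intro Ck_on_inverse Ck_on_fst) auto
  show "Cinf_on (time_interval T) c1" using Ck by (simp add: Cinf_on_def I_def)
  have "Ck_on k I b1" for k
  proof -
    have "Ck_on k I (\<lambda>t. B1 * t + B0)" by (intro Ck_on_add Ck_on_mult Ck_on_const id)
    thus ?thesis using Ck_on_cong[of I b1 "\<lambda>t. B1 * t + B0" k] B(2) by simp
  qed
  thus "Cinf_on (time_interval T) b1" by (simp add: Cinf_on_def I_def)
  have "Ck_on k (I \<times> UNIV) (\<lambda>(t, x). c2 t x)" for k
  proof -
    have "Ck_on k (I \<times> (UNIV :: real set)) (\<lambda>p. (c1 0 * c2 0 0) * inverse (c1 (fst p)))"
      by (intro Ck_on_mult Ck_on_const inv)
    thus ?thesis using B(1)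
      by (subst Ck_on_cong[of _ _ "\<lambda>p. (c1 0 * c2 0 0) * inverse (c1 (fst p))"]) (auto simp: divide_inverse)
  qed
  thus "Cinf_on (time_interval T \<times> UNIV) (\<lambda>(t, x). c2 t x)" by (simp add: Cinf_on_def I_def)
  have "Ck_on k (I \<times> UNIV) (\<lambda>(t, x). b2 t x)" for k
  proof -
    have "Ck_on k (I \<times> (UNIV :: real set))
       (\<lambda>p. c1' (fst p) * inverse (c1 (fst p)) * (snd p + (- B1) * fst p + (- B0)) + B1)"
      using Ck[of k] by (intro Ck_on_mult Ck_on_add Ck_on_const inv fst snd Ck_on_fst) auto
    thus ?thesis using B(3)
      by (subst Ck_on_cong[of _ _ "\<lambda>p. c1' (fst p) * inverse (c1 (fst p)) * (snd p + (- B1) * fst p + (- B0)) + B1"])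
         (auto simp: divide_inverse)
  qed
  thus "Cinf_on (time_interval T \<times> UNIV) (\<lambda>(t, x). b2 t x)" by (simp add: Cinf_on_def I_def)
  have "relation_a lam I (c1 0) (Dt I c1 0) (c2 0 0) c1"
    unfolding relation_a_def using c1nz Dt_eq[OF I B(4)] by (simp add: c1'_def)
  moreover have "relation_b I (c1 0) (c2 0 0) B0 B1 b1 c1 b2 (\<lambda>t. c2 t 0)"
    unfolding relation_b_def using B(1-3) by (simp add: c1'_def)
  moreover have "\<forall>t\<in>I. \<forall>x. c2 t x = c2 t 0" using B(1) by metis
  ultimately show "\<exists>c2' B0 B1.
       (\<forall>t\<in>time_interval T. \<forall>x. c2 t x = c2' t) \<and>
       relation_a lam (time_interval T) (c1 0) (Dt (time_interval T) c1 0) (c2' 0) c1 \<and>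
       relation_b (time_interval T) (c1 0) (c2' 0) B0 B1 b1 c1 b2 c2'"
    \<comment> \<open>The slice x = 0 represents the x-independent width.\<close>
    unfolding I_def by (intro exI[of _ "\<lambda>t. c2 t 0"] exI[of _ B0] exI[of _ B1] conjI)
qed

section \<open>Verification of the explicit solution, and conclusion\<close>

lemma gaussian_KIE_solution:
  assumes "lam > 0" "c10 > 0" "c20 > 0" "Cinf_on {0..} c1"
    and a: "relation_a lam {0..} c10 c11 c20 c1" and b: "relation_b {0..} c10 c20 B0 B1 b1 c1 b2 c2"
    and f: "\<And>t x \<xi>. t \<ge> 0 \<Longrightarrow> f t x \<xi> = gaussian_ansatz b1 c1 b2 (\<lambda>t x. c2 t) t x \<xi>"
  shows "KIE_solution lam {0..} f"
proof (rule KIE_solution_gaussian[where C = "c10 * c20" and ?c1.0 = c1 and c1' = "Dt {0..} c1" and ?B0.0 = B0 and ?B1.0 = B1])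
  note c1 = relation_a_scale_ode[OF assms(1) assms(4) assms(2) a]
  fix t :: real assume t: "t \<in> {0..}"
  show "at t within {0..} \<noteq> bot" using t by (rule half_line_not_bot)
  show "c1 t > 0" "(c1 has_real_derivative Dt {0..} c1 t) (at t within {0..})"
    "(Dt {0..} c1 has_real_derivative 2 * lam / c1 t + (c10 * c20)\<^sup>2 / c1 t ^ 3) (at t within {0..})"
    using c1 t by auto
  show "f t x \<xi> = gaussian_ansatz (\<lambda>t. B1 * t + B0) c1
        (\<lambda>t x. Dt {0..} c1 t / c1 t * (x - B1 * t - B0) + B1) (\<lambda>t x. c10 * c20 / c1 t) t x \<xi>" for x \<xi>
    using f[of t x \<xi>] b t by (simp add: gaussian_ansatz_def relation_b_def)
qed (use assms in simp)

theorem theorem1p15: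
  fixes lam :: real
  assumes "lam > 0"
  shows
    "(\<forall>c10 c20 c11 B0 B1 c1 c2 b1 b2 f.
        c10 > 0 \<and> c20 > 0 \<and>
        Cinf_on {0..} c1 \<and> relation_a lam {0..} c10 c11 c20 c1 \<and>
        relation_b {0..} c10 c20 B0 B1 b1 c1 b2 c2 \<and>
        (\<forall>t\<ge>0. \<forall>x \<xi>. f t x \<xi> = gaussian_ansatz b1 c1 b2 (\<lambda>t x. c2 t) t x \<xi>) \<longrightarrow>
        KIE_solution lam {0..} f \<and>
        (\<forall>\<tau> ftilde.
           is_tau lam \<tau> \<and>
           (\<forall>t\<ge>0. \<forall>x \<xi>. f t x \<xi> =
              1 / L1_norm (\<lambda>y. (gauss y)\<^sup>2) *
                ftilde t (x / \<tau> t) (\<tau> t * \<xi> - Dt UNIV \<tau> t * x)) \<longrightarrow>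
           (\<forall>t\<ge>0. \<forall>y. integrable lborel (ftilde t y)) \<and>
           (\<forall>t\<ge>0. integrable lborel (\<lambda>y. spatial_density ftilde t y - (gauss y)\<^sup>2)) \<and>
           (\<lambda>t. L1_norm (\<lambda>y. spatial_density ftilde t y - (gauss y)\<^sup>2))
             \<in> O[at_top](\<lambda>t. sqrt (ln (ln t) / ln t))))
     \<and>
     (\<forall>(T::ereal) b1 c1 b2 c2 f.
        T > 0 \<and>
        Ck_on 1 (time_interval T) b1 \<and>
        Ck_on 1 (time_interval T) c1 \<and> (\<forall>t\<in>time_interval T. c1 t > 0) \<and>
        Ck_on 1 (time_interval T \<times> UNIV) (\<lambda>(t, x). b2 t x) \<and>
        Ck_on 1 (time_interval T \<times> UNIV) (\<lambda>(t, x). c2 t x) \<and>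
        (\<forall>t\<in>time_interval T. \<forall>x. c2 t x > 0) \<and>
        (\<forall>t\<in>time_interval T. \<forall>x \<xi>. f t x \<xi> = gaussian_ansatz b1 c1 b2 c2 t x \<xi>) \<and>
        KIE_solution lam (time_interval T) f \<longrightarrow>
        Cinf_on (time_interval T) b1 \<and>
        Cinf_on (time_interval T) c1 \<and>
        Cinf_on (time_interval T \<times> UNIV) (\<lambda>(t, x). b2 t x) \<and>
        Cinf_on (time_interval T \<times> UNIV) (\<lambda>(t, x). c2 t x) \<and>
        (\<exists>c2' B0 B1.
           (\<forall>t\<in>time_interval T. \<forall>x. c2 t x = c2' t) \<and>
           relation_a lam (time_interval T) (c1 0) (Dt (time_interval T) c1 0) (c2' 0) c1 \<and>
           relation_b (time_interval T) (c1 0) (c2' 0) B0 B1 b1 c1 b2 c2'))"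
proof (intro conjI allI impI; elim conjE)
  fix c10 c20 c11 B0 B1 c1 c2 b1 b2 f
  assume 1: "c10 > 0" "c20 > 0" "Cinf_on {0..} c1" "relation_a lam {0..} c10 c11 c20 c1"
    "relation_b {0..} c10 c20 B0 B1 b1 c1 b2 c2"
    and "\<forall>t\<ge>0. \<forall>x \<xi>. f t x \<xi> = gaussian_ansatz b1 c1 b2 (\<lambda>t x. c2 t) t x \<xi>"
  hence f: "\<And>t x \<xi>. t \<ge> 0 \<Longrightarrow> f t x \<xi> = gaussian_ansatz b1 c1 b2 (\<lambda>t x. c2 t) t x \<xi>" by blast
  show "KIE_solution lam {0..} f" using gaussian_KIE_solution[OF assms 1 f] .
  fix \<tau> ftilde
  assume 2: "is_tau lam \<tau>" "\<forall>t\<ge>0. \<forall>x \<xi>. f t x \<xi> =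
              1 / L1_norm (\<lambda>y. (gauss y)\<^sup>2) * ftilde t (x / \<tau> t) (\<tau> t * \<xi> - Dt UNIV \<tau> t * x)"
  note asymp = gaussian_solution_asymptotics[OF assms 1 f 2(1), of ftilde]
  show "integrable lborel (ftilde t y)" if "t \<ge> 0" for t y
    using that 2(2) by (intro asymp(1)) auto
  show "integrable lborel (\<lambda>y. spatial_density ftilde t y - (gauss y)\<^sup>2)" if "t \<ge> 0" for t
    using that 2(2) by (intro asymp(2)) auto
  show "(\<lambda>t. L1_norm (\<lambda>y. spatial_density ftilde t y - (gauss y)\<^sup>2)) \<in> O[at_top](\<lambda>t. sqrt (ln (ln t) / ln t))"
    using 2(2) by (intro asymp(3)) auto
next
  fix T :: ereal and b1 c1 :: "real \<Rightarrow> real" and b2 c2 :: "real \<Rightarrow> real \<Rightarrow> real"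
    and f :: "real \<Rightarrow> real \<Rightarrow> real \<Rightarrow> real"
  assume "T > 0" "Ck_on 1 (time_interval T) b1" "Ck_on 1 (time_interval T) c1"
    "\<forall>t\<in>time_interval T. c1 t > 0"
    "Ck_on 1 (time_interval T \<times> UNIV) (\<lambda>(t, x). b2 t x)"
    "Ck_on 1 (time_interval T \<times> UNIV) (\<lambda>(t, x). c2 t x)"
    "\<forall>t\<in>time_interval T. \<forall>x. c2 t x > 0"
    "\<forall>t\<in>time_interval T. \<forall>x \<xi>. f t x \<xi> = gaussian_ansatz b1 c1 b2 c2 t x \<xi>"
    "KIE_solution lam (time_interval T) f"
  note * = this
  note rigid = gaussian_solution_rigidity[OF *(1-3) *(4)[rule_format] *(5,6) *(7)[rule_format] *(8)[rule_format] *(9)]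
  show "Cinf_on (time_interval T) b1" "Cinf_on (time_interval T) c1"
    "Cinf_on (time_interval T \<times> UNIV) (\<lambda>(t, x). b2 t x)"
    "Cinf_on (time_interval T \<times> UNIV) (\<lambda>(t, x). c2 t x)"
    "\<exists>c2' B0 B1.
       (\<forall>t\<in>time_interval T. \<forall>x. c2 t x = c2' t) \<and>
       relation_a lam (time_interval T) (c1 0) (Dt (time_interval T) c1 0) (c2' 0) c1 \<and>
       relation_b (time_interval T) (c1 0) (c2' 0) B0 B1 b1 c1 b2 c2'"
    by (rule rigid; assumption?)+
qed

end
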